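(* Let $\mathscr{C}$ be an exponential category and let $\rho\colon\mathscr{I}\to\mathbf{Fun}(\mathscr{C},\mathscr{D})$ be a signature. Then the Cartesian Yoneda functor $\mathrm{Ca}\colon\mathbf{Struct}^\rho\to\mathbf{Struct}^{\rho^{\mathscr{C}}}$ is full and faithful.
   Context: A full subcategory $\mathscr{C}$ of $\mathbf{Set}$ is exponential when it is closed under taking subsets and forming exponential objects ($A^C$ denotes the set of functions $C\to A$). Images: for a morphism $h\colon A\to B$ in a category, an image candidate is a triple $(V,\theta,\psi)$ with $\theta\colon A\to V$, $\psi\colon V\to B$ monic and $h=\psi\circ\theta$; it is an image triple if for every image candidate $(V_2,\theta_2,\psi_2)$ of $h$ there is a unique $s\colon V\to V_2$ with $\psi_2\circ s=\psi$. Then $\mathrm{im}(h)$ is the subobject of $B$ containing $\psi$. Subobjects are equivalence classes of monomorphisms with the usual order $\le$. Signatures: a functor $\rho\colon\mathscr{I}\to\mathbf{Fun}(\mathscr{C},\mathscr{D})$ is a presignature. For $A\in\mathrm{Ob}(\mathscr{C})$ let $\rho_A\colon\mathscr{I}\to\mathscr{D}$ be $\rho_A(N):=\rho(N)(A)$, $\rho_A(\nu):=\rho(\nu)_A$, and for $h\colon A\to B$ in $\mathscr{C}$ let $\rho_h\colon\rho_A\to\rho_B$ be the natural transformation $(\rho_h)_N:=\rho(N)(h)$. The presignature $\rho$ is a signature when for every monomorphism $F\colon U\hookrightarrow\rho_A$ in $\mathbf{Fun}(\mathscr{I},\mathscr{D})$ and every $h\colon A\to B$ in $\mathscr{C}$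 the image $\mathrm{im}(\rho_h\circ F)$ exists in $\mathbf{Fun}(\mathscr{I},\mathscr{D})$. Structures: a structure of signature $\rho$ on $A$ is a subobject $\mathbf{A}$ of $\rho_A$ in $\mathbf{Fun}(\mathscr{I},\mathscr{D})$, written $(A,F)$ for a representing monomorphism $F$. For $h\colon A\to B$, $h(\mathbf{A}):=\mathrm{im}(\rho_h\circ F)$. A morphism $h\colon\mathbf{A}\to\mathbf{B}$ from a structure on $A$ to a structure on $B$ is a morphism $h\colon A\to B$ of $\mathscr{C}$ with $h(\mathbf{A})\le\mathbf{B}$ as subobjects of $\rho_B$. $\mathbf{Struct}^\rho$ is the category of structures of signature $\rho$ and such morphisms, with identities and composition from $\mathscr{C}$. $\mathrm{Struct}^\rho_A$ is the class of structures of signature $\rho$ on $A$. Yoneda signature: $\rho^{\mathscr{C}}\colon(\mathbf{Struct}^\rho)^{\mathrm{op}}\to\mathbf{Fun}(\mathscr{C},\mathscr{C})$ is given as follows. For $\mathbf{C}\in\mathrm{Struct}^\rho_C$, $\rho^{\mathscr{C}}(\mathbf{C})(A):=A^C$ and $\rho^{\mathscr{C}}(\mathbf{C})(h):=h\circ\_\colon A_1^C\to A_2^C$ for $h\colon A_1\to A_2$. For $f\colon\mathbf{C}_2\to\mathbf{C}_1$ in $\mathbf{Struct}^\rho$, $\rho^{\mathscr{C}}(f)_A:=\_\circ f\colon A^{C_1}\to A^{C_2}$. This is a signature. Exponential Yoneda functor: for $\mathbf{A}\in\mathrm{Struct}^\rho_A$, $\mathrm{Yo}^{\mathscr{C}}_{\mathbf{A}}\colon(\mathbf{Struct}^\rho)^{\mathrm{op}}\to\mathscr{C}$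 is $\mathbf{C}\mapsto\hom(\mathbf{C},\mathbf{A})\subseteq A^C$, acting on morphisms by precomposition. Cartesian Yoneda functor: $\mathrm{Ca}\colon\mathbf{Struct}^\rho\to\mathbf{Struct}^{\rho^{\mathscr{C}}}$ sends $\mathbf{A}\in\mathrm{Struct}^\rho_A$ to the subobject of $\rho^{\mathscr{C}}_A$ containing the monomorphism $F_{\mathbf{A}}\colon\mathrm{Yo}^{\mathscr{C}}_{\mathbf{A}}\hookrightarrow\rho^{\mathscr{C}}_A$ with components $(F_{\mathbf{A}})_{\mathbf{C}}\colon\hom(\mathbf{C},\mathbf{A})\to A^C$, $f\mapsto f$, and sends $h\colon\mathbf{A}_1\to\mathbf{A}_2$ to $\mathrm{Ca}(h):=h$. *)

theory Defs
  imports Main "HOL-Library.FuncSet"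
begin

section \<open>Categories\<close>

record ('o, 'a) category =
  Ob :: "'o set"
  Ar :: "'a set"
  Dom :: "'a \<Rightarrow> 'o"
  Cod :: "'a \<Rightarrow> 'o"
  Ident :: "'o \<Rightarrow> 'a"
  Comp :: "'a \<Rightarrow> 'a \<Rightarrow> 'a"

definition hom :: "('o, 'a) category \<Rightarrow> 'o \<Rightarrow> 'o \<Rightarrow> 'a set" where
  "hom K A B = {f \<in> Ar K. Dom K f = A \<and> Cod K f = B}"

definition is_category :: "('o, 'a) category \<Rightarrow> bool" where
  "is_category K \<longleftrightarrow>
     (\<forall>f\<in>Ar K. Dom K f \<in> Ob K \<and> Cod K f \<in> Ob K) \<and>
     (\<forall>A\<in>Ob K. Ident K A \<in> hom K A A) \<and>
     (\<forall>f\<in>Ar K. \<forall>g\<in>Ar K. Cod K f = Dom K g \<longrightarrow> Comp K g f \<in> hom K (Dom K f) (Cod K g)) \<and>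
     (\<forall>f\<in>Ar K. Comp K f (Ident K (Dom K f)) = f \<and> Comp K (Ident K (Cod K f)) f = f) \<and>
     (\<forall>f\<in>Ar K. \<forall>g\<in>Ar K. \<forall>h\<in>Ar K. Cod K f = Dom K g \<and> Cod K g = Dom K h \<longrightarrow>
        Comp K h (Comp K g f) = Comp K (Comp K h g) f)"

definition op_cat :: "('o, 'a) category \<Rightarrow> ('o, 'a) category" where
  "op_cat K = \<lparr>Ob = Ob K, Ar = Ar K, Dom = Cod K, Cod = Dom K,
               Ident = Ident K, Comp = (\<lambda>g f. Comp K f g)\<rparr>"

definition full_subcat :: "('o, 'a) category \<Rightarrow> 'o set \<Rightarrow> ('o, 'a) category" where
  "full_subcat K X = K\<lparr>Ob := X, Ar := {f \<in> Ar K. Dom K f \<in> X \<and> Cod K f \<in> X}\<rparr>"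

text \<open>In the categories constructed below, arrows carry their domain and codomain explicitly,
  since the same underlying datum may be a morphism between different objects.\<close>

datatype ('o, 'x) arrow = Arrow (src: 'o) (und: 'x) (trg: 'o)


section \<open>Functors and natural transformations\<close>

record ('o1, 'a1, 'o2, 'a2) cfunctor =
  FOb :: "'o1 \<Rightarrow> 'o2"
  FAr :: "'a1 \<Rightarrow> 'a2"

text \<open>Functors and natural transformations are \<^const>\<open>undefined\<close> outside their domain,
  so that equality of the HOL objects is equality of functors and of transformations.\<close>

definition is_functor ::
    "('o1, 'a1) category \<Rightarrow> ('o2, 'a2) category \<Rightarrow> ('o1, 'a1, 'o2, 'a2) cfunctor \<Rightarrow> bool" where
  "is_functor K L F \<longleftrightarrow>
     is_category K \<and> is_category L \<and>
     FOb F \<in> Ob K \<rightarrow>\<^sub>E Ob L \<and>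
     FAr F \<in> extensional (Ar K) \<and>
     (\<forall>f\<in>Ar K. FAr F f \<in> hom L (FOb F (Dom K f)) (FOb F (Cod K f))) \<and>
     (\<forall>A\<in>Ob K. FAr F (Ident K A) = Ident L (FOb F A)) \<and>
     (\<forall>f\<in>Ar K. \<forall>g\<in>Ar K. Cod K f = Dom K g \<longrightarrow>
        FAr F (Comp K g f) = Comp L (FAr F g) (FAr F f))"

definition full ::
    "('o1, 'a1) category \<Rightarrow> ('o2, 'a2) category \<Rightarrow> ('o1, 'a1, 'o2, 'a2) cfunctor \<Rightarrow> bool" where
  "full K L F \<longleftrightarrow>
     (\<forall>A\<in>Ob K. \<forall>B\<in>Ob K. FAr F ` hom K A B = hom L (FOb F A) (FOb F B))"

definition faithful ::
    "('o1, 'a1) category \<Rightarrow> ('o2, 'a2) category \<Rightarrow> ('o1, 'a1, 'o2, 'a2) cfunctor \<Rightarrow> bool" where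
  "faithful K L F \<longleftrightarrow> (\<forall>A\<in>Ob K. \<forall>B\<in>Ob K. inj_on (FAr F) (hom K A B))"

definition is_nat_trans ::
    "('o1, 'a1) category \<Rightarrow> ('o2, 'a2) category \<Rightarrow> ('o1, 'a1, 'o2, 'a2) cfunctor \<Rightarrow>
     ('o1, 'a1, 'o2, 'a2) cfunctor \<Rightarrow> ('o1 \<Rightarrow> 'a2) \<Rightarrow> bool" where
  "is_nat_trans K L F G \<eta> \<longleftrightarrow>
     is_functor K L F \<and> is_functor K L G \<and>
     \<eta> \<in> extensional (Ob K) \<and>
     (\<forall>A\<in>Ob K. \<eta> A \<in> hom L (FOb F A) (FOb G A)) \<and>
     (\<forall>f\<in>Ar K. Comp L (\<eta> (Cod K f)) (FAr F f) = Comp L (FAr G f) (\<eta> (Dom K f)))"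

type_synonym ('o1, 'a1, 'o2, 'a2) nt =
  "(('o1, 'a1, 'o2, 'a2) cfunctor, 'o1 \<Rightarrow> 'a2) arrow"

definition Fun_cat ::
    "('o1, 'a1) category \<Rightarrow> ('o2, 'a2) category \<Rightarrow>
     (('o1, 'a1, 'o2, 'a2) cfunctor, ('o1, 'a1, 'o2, 'a2) nt) category" where
  "Fun_cat K L =
     \<lparr>Ob = {F. is_functor K L F},
      Ar = {t. is_nat_trans K L (src t) (trg t) (und t)},
      Dom = src, Cod = trg,
      Ident = (\<lambda>F. Arrow F (\<lambda>A\<in>Ob K. Ident L (FOb F A)) F),
      Comp = (\<lambda>t s. Arrow (src s) (\<lambda>A\<in>Ob K. Comp L (und t A) (und s A)) (trg t))\<rparr>"


section \<open>Subobjects and images\<close>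

definition is_mono :: "('o, 'a) category \<Rightarrow> 'a \<Rightarrow> bool" where
  "is_mono K m \<longleftrightarrow> m \<in> Ar K \<and>
     (\<forall>f\<in>Ar K. \<forall>g\<in>Ar K. Dom K f = Dom K g \<and> Cod K f = Dom K m \<and> Cod K g = Dom K m \<and>
        Comp K m f = Comp K m g \<longrightarrow> f = g)"

definition mono_le :: "('o, 'a) category \<Rightarrow> 'a \<Rightarrow> 'a \<Rightarrow> bool" where
  "mono_le K m n \<longleftrightarrow> Cod K m = Cod K n \<and> (\<exists>s\<in>hom K (Dom K m) (Dom K n). Comp K n s = m)"

definition subobject :: "('o, 'a) category \<Rightarrow> 'a \<Rightarrow> 'a set" where
  "subobject K m = {n. is_mono K n \<and> mono_le K m n \<and> mono_le K n m}"

definition subobjects :: "('o, 'a) category \<Rightarrow> 'o \<Rightarrow> 'a set set" where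
  "subobjects K B = {subobject K m | m. is_mono K m \<and> Cod K m = B}"

definition subobject_le :: "('o, 'a) category \<Rightarrow> 'a set \<Rightarrow> 'a set \<Rightarrow> bool" where
  "subobject_le K S T \<longleftrightarrow> (\<exists>m\<in>S. \<exists>n\<in>T. mono_le K m n)"

definition image_candidate :: "('o, 'a) category \<Rightarrow> 'a \<Rightarrow> 'o \<Rightarrow> 'a \<Rightarrow> 'a \<Rightarrow> bool" where
  "image_candidate K h V \<theta> \<psi> \<longleftrightarrow>
     V \<in> Ob K \<and> \<theta> \<in> hom K (Dom K h) V \<and> \<psi> \<in> hom K V (Cod K h) \<and>
     is_mono K \<psi> \<and> h = Comp K \<psi> \<theta>"

definition image_triple :: "('o, 'a) category \<Rightarrow> 'a \<Rightarrow> 'o \<Rightarrow> 'a \<Rightarrow> 'a \<Rightarrow> bool" where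
  "image_triple K h V \<theta> \<psi> \<longleftrightarrow>
     image_candidate K h V \<theta> \<psi> \<and>
     (\<forall>V2 \<theta>2 \<psi>2. image_candidate K h V2 \<theta>2 \<psi>2 \<longrightarrow>
        (\<exists>!s. s \<in> hom K V V2 \<and> Comp K \<psi>2 s = \<psi>))"

definition has_image :: "('o, 'a) category \<Rightarrow> 'a \<Rightarrow> bool" where
  "has_image K h \<longleftrightarrow> (\<exists>V \<theta> \<psi>. image_triple K h V \<theta> \<psi>)"

definition im :: "('o, 'a) category \<Rightarrow> 'a \<Rightarrow> 'a set" where
  "im K h = (THE S. \<exists>V \<theta> \<psi>. image_triple K h V \<theta> \<psi> \<and> S = subobject K \<psi>)"


section \<open>Signatures and structures\<close>

type_synonym ('io, 'ia, 'co, 'ca, 'do, 'da) presig =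
  "('io, 'ia, ('co, 'ca, 'do, 'da) cfunctor, ('co, 'ca, 'do, 'da) nt) cfunctor"

definition presignature ::
    "('io, 'ia) category \<Rightarrow> ('co, 'ca) category \<Rightarrow> ('do, 'da) category \<Rightarrow>
     ('io, 'ia, 'co, 'ca, 'do, 'da) presig \<Rightarrow> bool" where
  "presignature I C D \<rho> \<longleftrightarrow>
     is_category I \<and> is_category C \<and> is_category D \<and> is_functor I (Fun_cat C D) \<rho>"

text \<open>The functor \<open>\<rho>\<^sub>A\<close> and the natural transformation \<open>\<rho>\<^sub>h\<close>.\<close>

definition sig_at ::
    "('io, 'ia) category \<Rightarrow> ('io, 'ia, 'co, 'ca, 'do, 'da) presig \<Rightarrow> 'co \<Rightarrow>
     ('io, 'ia, 'do, 'da) cfunctor" where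
  "sig_at I \<rho> A = \<lparr>FOb = (\<lambda>N\<in>Ob I. FOb (FOb \<rho> N) A), FAr = (\<lambda>\<nu>\<in>Ar I. und (FAr \<rho> \<nu>) A)\<rparr>"

definition sig_map ::
    "('io, 'ia) category \<Rightarrow> ('co, 'ca) category \<Rightarrow> ('io, 'ia, 'co, 'ca, 'do, 'da) presig \<Rightarrow> 'ca \<Rightarrow>
     ('io, 'ia, 'do, 'da) nt" where
  "sig_map I C \<rho> h =
     Arrow (sig_at I \<rho> (Dom C h)) (\<lambda>N\<in>Ob I. FAr (FOb \<rho> N) h) (sig_at I \<rho> (Cod C h))"

definition signature ::
    "('io, 'ia) category \<Rightarrow> ('co, 'ca) category \<Rightarrow> ('do, 'da) category \<Rightarrow>
     ('io, 'ia, 'co, 'ca, 'do, 'da) presig \<Rightarrow> bool" where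
  "signature I C D \<rho> \<longleftrightarrow>
     presignature I C D \<rho> \<and>
     (\<forall>h\<in>Ar C. \<forall>F. is_mono (Fun_cat I D) F \<and> Cod (Fun_cat I D) F = sig_at I \<rho> (Dom C h) \<longrightarrow>
        has_image (Fun_cat I D) (Comp (Fun_cat I D) (sig_map I C \<rho> h) F))"

text \<open>A structure is a pair of its underlying object \<open>A\<close> and a subobject of \<open>\<rho>\<^sub>A\<close>; the object is
  recorded because \<open>\<rho>\<^sub>A\<close> need not determine \<open>A\<close>.\<close>

type_synonym ('io, 'ia, 'co, 'do, 'da) strct = "'co \<times> ('io, 'ia, 'do, 'da) nt set"

type_synonym ('io, 'ia, 'co, 'ca, 'do, 'da) structure_map =
  "(('io, 'ia, 'co, 'do, 'da) strct, 'ca) arrow"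

definition structures ::
    "('io, 'ia) category \<Rightarrow> ('co, 'ca) category \<Rightarrow> ('do, 'da) category \<Rightarrow>
     ('io, 'ia, 'co, 'ca, 'do, 'da) presig \<Rightarrow> ('io, 'ia, 'co, 'do, 'da) strct set" where
  "structures I C D \<rho> = {(A, S). A \<in> Ob C \<and> S \<in> subobjects (Fun_cat I D) (sig_at I \<rho> A)}"

definition direct_image ::
    "('io, 'ia) category \<Rightarrow> ('co, 'ca) category \<Rightarrow> ('do, 'da) category \<Rightarrow>
     ('io, 'ia, 'co, 'ca, 'do, 'da) presig \<Rightarrow> 'ca \<Rightarrow> ('io, 'ia, 'do, 'da) nt set \<Rightarrow>
     ('io, 'ia, 'do, 'da) nt set" where
  "direct_image I C D \<rho> h S =
     im (Fun_cat I D) (Comp (Fun_cat I D) (sig_map I C \<rho> h) (SOME F. F \<in> S))"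

definition Struct ::
    "('io, 'ia) category \<Rightarrow> ('co, 'ca) category \<Rightarrow> ('do, 'da) category \<Rightarrow>
     ('io, 'ia, 'co, 'ca, 'do, 'da) presig \<Rightarrow>
     (('io, 'ia, 'co, 'do, 'da) strct, ('io, 'ia, 'co, 'ca, 'do, 'da) structure_map) category"
  where
  "Struct I C D \<rho> =
     \<lparr>Ob = structures I C D \<rho>,
      Ar = {f. src f \<in> structures I C D \<rho> \<and> trg f \<in> structures I C D \<rho> \<and>
               und f \<in> hom C (fst (src f)) (fst (trg f)) \<and>
               subobject_le (Fun_cat I D)
                 (direct_image I C D \<rho> (und f) (snd (src f))) (snd (trg f))},
      Dom = src, Cod = trg,
      Ident = (\<lambda>X. Arrow X (Ident C (fst X)) X),
      Comp = (\<lambda>g f. Arrow (src f) (Comp C (und g) (und f)) (trg g))\<rparr>"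


section \<open>The category of sets\<close>

text \<open>An arbitrary universe of sets, in which functions between sets are again sets. Only those
  Zermelo axioms needed to form function sets are required; separation is for arbitrary
  predicates of the logic.\<close>

class set_universe =
  fixes elts :: "'a \<Rightarrow> 'a set"
  assumes elts_extensionality: "elts a = elts b \<Longrightarrow> a = b"
    and elts_separation: "X \<subseteq> elts a \<Longrightarrow> \<exists>b. elts b = X"
    and elts_pairing: "\<exists>c. elts c = {a, b}"
    and elts_union: "\<exists>b. elts b = (\<Union>x\<in>elts a. elts x)"
    and elts_power: "\<exists>b. elts b = {x. elts x \<subseteq> elts a}"

text \<open>The element of the universe with the given extension, meaningful only when there is one.\<close>

definition vset :: "'v::set_universe set \<Rightarrow> 'v" where
  "vset X = (THE a. elts a = X)"

definition opair :: "'v::set_universe \<Rightarrow> 'v \<Rightarrow> 'v" where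
  "opair a b = vset {vset {a}, vset {a, b}}"

text \<open>Functions between elements of the universe are identified with their graphs.\<close>

definition graph :: "'v::set_universe \<Rightarrow> ('v \<Rightarrow> 'v) \<Rightarrow> 'v" where
  "graph A f = vset ((\<lambda>x. opair x (f x)) ` elts A)"

definition vcomp :: "'v::set_universe \<Rightarrow> 'v \<Rightarrow> 'v" where
  "vcomp g f = vset {opair x z | x y z. opair x y \<in> elts f \<and> opair y z \<in> elts g}"

text \<open>\<open>vexp A C\<close> is the function set \<open>A\<^sup>C\<close>.\<close>

definition vexp :: "'v::set_universe \<Rightarrow> 'v \<Rightarrow> 'v" where
  "vexp A C = vset {graph C f | f. f \<in> elts C \<rightarrow> elts A}"

type_synonym 'v set_map = "('v, 'v) arrow"

definition Set_cat :: "('v::set_universe, 'v set_map) category" where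
  "Set_cat =
     \<lparr>Ob = UNIV,
      Ar = {f. und f \<in> elts (vexp (trg f) (src f))},
      Dom = src, Cod = trg,
      Ident = (\<lambda>A. Arrow A (graph A (\<lambda>x. x)) A),
      Comp = (\<lambda>g f. Arrow (src f) (vcomp (und g) (und f)) (trg g))\<rparr>"

definition exponential_category :: "('v::set_universe, 'v set_map) category \<Rightarrow> bool" where
  "exponential_category C \<longleftrightarrow>
     (\<exists>X. C = full_subcat Set_cat X) \<and>
     (\<forall>A\<in>Ob C. \<forall>B. elts B \<subseteq> elts A \<longrightarrow> B \<in> Ob C) \<and>
     (\<forall>A\<in>Ob C. \<forall>B\<in>Ob C. vexp A B \<in> Ob C)"


section \<open>The Yoneda signature and the Cartesian Yoneda functor\<close>

text \<open>The maps \<open>h \<circ> _ : A\<^sub>1\<^sup>C \<rightarrow> A\<^sub>2\<^sup>C\<close> for \<open>h : A\<^sub>1 \<rightarrow> A\<^sub>2\<close> and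
  \<open>_ \<circ> f : A\<^bsup>C1\<^esup> \<rightarrow> A\<^bsup>C2\<^esup>\<close> for \<open>f : C2 \<rightarrow> C1\<close>.\<close>

definition postcomp :: "'v::set_universe \<Rightarrow> 'v set_map \<Rightarrow> 'v set_map" where
  "postcomp C h =
     Arrow (vexp (src h) C) (graph (vexp (src h) C) (\<lambda>g. vcomp (und h) g)) (vexp (trg h) C)"

definition precomp :: "'v::set_universe set_map \<Rightarrow> 'v \<Rightarrow> 'v set_map" where
  "precomp f A =
     Arrow (vexp A (trg f)) (graph (vexp A (trg f)) (\<lambda>g. vcomp g (und f))) (vexp A (src f))"

definition exp_functor ::
    "('v::set_universe, 'v set_map) category \<Rightarrow> 'v \<Rightarrow> ('v, 'v set_map, 'v, 'v set_map) cfunctor" where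
  "exp_functor C B = \<lparr>FOb = (\<lambda>A\<in>Ob C. vexp A B), FAr = (\<lambda>h\<in>Ar C. postcomp B h)\<rparr>"

definition yoneda_sig ::
    "('io, 'ia) category \<Rightarrow> ('v::set_universe, 'v set_map) category \<Rightarrow> ('do, 'da) category \<Rightarrow>
     ('io, 'ia, 'v, 'v set_map, 'do, 'da) presig \<Rightarrow>
     (('io, 'ia, 'v, 'do, 'da) strct, ('io, 'ia, 'v, 'v set_map, 'do, 'da) structure_map,
      'v, 'v set_map, 'v, 'v set_map) presig" where
  "yoneda_sig I C D \<rho> =
     \<lparr>FOb = (\<lambda>X\<in>Ob (Struct I C D \<rho>). exp_functor C (fst X)),
      FAr = (\<lambda>f\<in>Ar (Struct I C D \<rho>).
               Arrow (exp_functor C (fst (trg f)))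
                     (\<lambda>A\<in>Ob C. precomp (und f) A)
                     (exp_functor C (fst (src f))))\<rparr>"

text \<open>The set \<open>hom(X, Y)\<close>, as a subset of \<open>A\<^sup>C\<close> for structures \<open>X\<close> on \<open>C\<close> and \<open>Y\<close> on \<open>A\<close>.\<close>

definition vhom ::
    "('io, 'ia) category \<Rightarrow> ('v::set_universe, 'v set_map) category \<Rightarrow> ('do, 'da) category \<Rightarrow>
     ('io, 'ia, 'v, 'v set_map, 'do, 'da) presig \<Rightarrow>
     ('io, 'ia, 'v, 'do, 'da) strct \<Rightarrow> ('io, 'ia, 'v, 'do, 'da) strct \<Rightarrow> 'v" where
  "vhom I C D \<rho> X Y = vset ((\<lambda>f. und (und f)) ` hom (Struct I C D \<rho>) X Y)"

definition Yo ::
    "('io, 'ia) category \<Rightarrow> ('v::set_universe, 'v set_map) category \<Rightarrow> ('do, 'da) category \<Rightarrow>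
     ('io, 'ia, 'v, 'v set_map, 'do, 'da) presig \<Rightarrow> ('io, 'ia, 'v, 'do, 'da) strct \<Rightarrow>
     (('io, 'ia, 'v, 'do, 'da) strct, ('io, 'ia, 'v, 'v set_map, 'do, 'da) structure_map,
      'v, 'v set_map) cfunctor" where
  "Yo I C D \<rho> Y =
     \<lparr>FOb = (\<lambda>X\<in>Ob (Struct I C D \<rho>). vhom I C D \<rho> X Y),
      FAr = (\<lambda>f\<in>Ar (Struct I C D \<rho>).
               Arrow (vhom I C D \<rho> (trg f) Y)
                     (graph (vhom I C D \<rho> (trg f) Y) (\<lambda>g. vcomp g (und (und f))))
                     (vhom I C D \<rho> (src f) Y))\<rparr>"

definition Yo_incl ::
    "('io, 'ia) category \<Rightarrow> ('v::set_universe, 'v set_map) category \<Rightarrow> ('do, 'da) category \<Rightarrow>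
     ('io, 'ia, 'v, 'v set_map, 'do, 'da) presig \<Rightarrow> ('io, 'ia, 'v, 'do, 'da) strct \<Rightarrow>
     (('io, 'ia, 'v, 'do, 'da) strct, ('io, 'ia, 'v, 'v set_map, 'do, 'da) structure_map,
      'v, 'v set_map) nt" where
  "Yo_incl I C D \<rho> Y =
     Arrow (Yo I C D \<rho> Y)
           (\<lambda>X\<in>Ob (Struct I C D \<rho>).
              Arrow (vhom I C D \<rho> X Y) (graph (vhom I C D \<rho> X Y) (\<lambda>f. f)) (vexp (fst Y) (fst X)))
           (sig_at (op_cat (Struct I C D \<rho>)) (yoneda_sig I C D \<rho>) (fst Y))"

definition Yoneda_Struct ::
    "('io, 'ia) category \<Rightarrow> ('v::set_universe, 'v set_map) category \<Rightarrow> ('do, 'da) category \<Rightarrow>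
     ('io, 'ia, 'v, 'v set_map, 'do, 'da) presig \<Rightarrow>
     ((('io, 'ia, 'v, 'do, 'da) strct, ('io, 'ia, 'v, 'v set_map, 'do, 'da) structure_map,
       'v, 'v, 'v set_map) strct,
      (('io, 'ia, 'v, 'do, 'da) strct, ('io, 'ia, 'v, 'v set_map, 'do, 'da) structure_map,
       'v, 'v set_map, 'v, 'v set_map) structure_map) category" where
  "Yoneda_Struct I C D \<rho> = Struct (op_cat (Struct I C D \<rho>)) C C (yoneda_sig I C D \<rho>)"

definition Ca_ob ::
    "('io, 'ia) category \<Rightarrow> ('v::set_universe, 'v set_map) category \<Rightarrow> ('do, 'da) category \<Rightarrow>
     ('io, 'ia, 'v, 'v set_map, 'do, 'da) presig \<Rightarrow> ('io, 'ia, 'v, 'do, 'da) strct \<Rightarrow>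
     (('io, 'ia, 'v, 'do, 'da) strct, ('io, 'ia, 'v, 'v set_map, 'do, 'da) structure_map,
      'v, 'v, 'v set_map) strct" where
  "Ca_ob I C D \<rho> Y =
     (fst Y, subobject (Fun_cat (op_cat (Struct I C D \<rho>)) C) (Yo_incl I C D \<rho> Y))"

definition Ca ::
    "('io, 'ia) category \<Rightarrow> ('v::set_universe, 'v set_map) category \<Rightarrow> ('do, 'da) category \<Rightarrow>
     ('io, 'ia, 'v, 'v set_map, 'do, 'da) presig \<Rightarrow>
     (('io, 'ia, 'v, 'do, 'da) strct, ('io, 'ia, 'v, 'v set_map, 'do, 'da) structure_map,
      (('io, 'ia, 'v, 'do, 'da) strct, ('io, 'ia, 'v, 'v set_map, 'do, 'da) structure_map,
       'v, 'v, 'v set_map) strct,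
      (('io, 'ia, 'v, 'do, 'da) strct, ('io, 'ia, 'v, 'v set_map, 'do, 'da) structure_map,
       'v, 'v set_map, 'v, 'v set_map) structure_map) cfunctor" where
  "Ca I C D \<rho> =
     \<lparr>FOb = (\<lambda>Y\<in>Ob (Struct I C D \<rho>). Ca_ob I C D \<rho> Y),
      FAr = (\<lambda>h\<in>Ar (Struct I C D \<rho>).
               Arrow (Ca_ob I C D \<rho> (src h)) (und h) (Ca_ob I C D \<rho> (trg h)))\<rparr>"

end

theory Submission
  imports Defs
begin

text \<open>Whether \<open>h : X \<rightarrow> Y\<close> is a morphism of structures only asks that \<open>\<rho>\<^sub>h \<circ> F\<close> factor through a
  representative of \<open>Y\<close>, for any representative \<open>F\<close> of \<open>X\<close>. For the Yoneda signature the
  representatives are the inclusions of the functors \<open>hom(_, X)\<close>, so factoring means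
  \<open>h \<circ> hom(Z, X) \<subseteq> hom(Z, Y)\<close> for every \<open>Z\<close>. This follows from composition when \<open>h\<close> is a
  morphism, and conversely the identity in \<open>hom(X, X)\<close> is sent to \<open>h\<close>. That the Yoneda signature is a
  signature rests on images in \<open>Fun(J, C)\<close> being computed pointwise, for which monomorphisms
  there have to be pointwise injective.\<close>

section \<open>The universe of sets\<close>

text \<open>Two obstacles shape the proof. First, the definition of a morphism of structures picks a
  representative by \<open>SOME\<close> and an image by \<open>THE\<close>, so nothing can be
  computed from it directly. The remedy is to use \<open>mono_le\<close> with an arbitrary arrow on
  its left: an image is the least monomorphism through which the arrow factors, and replacing a
  representative by an equivalent one does not affect factoring. Second, \<open>C\<close> is only
  known to be closed under subsets and exponentials, so the product in which a kernel pair usually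
  lives need not be an object of \<open>C\<close>. A power with a two-element exponent replaces it,
  and such an exponent is at hand exactly where it matters: two distinct points of a value of a
  functor already form a subset of that value. Once monomorphisms of functors are known to be
  injective at each object, a factoring function through one is unique at each object and therefore
  natural, so that the order of subobjects becomes inclusion of sets of values. Finally, the target
  of \<open>Ca\<close> is itself a category of structures, and the general theory applies to it only
  after the Yoneda signature has been shown to have the required images.\<close>

lemma elts_vset: "X \<subseteq> elts a \<Longrightarrow> elts (vset X) = X"
  unfolding vset_def
  using elts_separation[of X a] elts_extensionality by (metis (mono_tags, lifting) the_equality)

lemma elts_vset_pair: "elts (vset {a, b}) = {a, b}"
  using elts_pairing[of a b] elts_vset by (metis order_refl)

lemma ex_un: "\<exists>c. elts c = elts a \<union> elts b"
  using elts_pairing[of a b] elts_union by (metis Union_insert Union_empty Un_empty_right image_insert image_empty)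

lemma elts_vset_singleton: "elts (vset {a}) = {a}"
  using elts_vset_pair[of a a] by simp

lemma opair_inject [simp]: "opair a b = opair c d \<longleftrightarrow> a = c \<and> b = d"
proof
  assume "opair a b = opair c d"
  \<comment> \<open>Taking extensions at both levels gives an equation between HOL sets of sets, to
    which the usual argument for Kuratowski pairs applies.\<close>
  then have "elts ` elts (opair a b) = elts ` elts (opair c d)" by simp
  then have "{{a}, {a, b}} = {{c}, {c, d}}"
    unfolding opair_def elts_vset_pair image_insert image_empty elts_vset_singleton .
  then show "a = c \<and> b = d" by (metis doubleton_eq_iff singleton_insert_inj_eq)
qed simp

section \<open>Bounds for graphs and function sets\<close>

text \<open>A Kuratowski pair of points of \<open>a\<close> and \<open>b\<close> lies in the double
  power set of their union. Such bounds are what \<open>elts_vset\<close> asks for, since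
  \<open>vset\<close> has a meaning only for classes contained in an element of the
  universe.\<close>

lemma ex_opairs: "\<exists>c. \<forall>x\<in>elts a. \<forall>y\<in>elts b. opair x y \<in> elts c"
proof -
  obtain u where u: "elts u = elts a \<union> elts b" using ex_un by blast
  obtain p where p: "elts p = {x. elts x \<subseteq> elts u}" using elts_power by blast
  obtain q where q: "elts q = {x. elts x \<subseteq> elts p}" using elts_power by blast
  have "opair x y \<in> elts q" if "x \<in> elts a" "y \<in> elts b" for x y
    using that by (simp add: opair_def elts_vset_pair elts_vset_singleton q p u)
  then show ?thesis by blast
qed

lemma elts_graph:
  assumes "f \<in> elts A \<rightarrow> elts B"
  shows "elts (graph A f) = (\<lambda>x. opair x (f x)) ` elts A"
proof -
  obtain c where "\<forall>x\<in>elts A. \<forall>y\<in>elts B. opair x y \<in> elts c" using ex_opairs by blast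
  then show ?thesis unfolding graph_def using assms by (intro elts_vset[of _ c]) auto
qed

text \<open>A graph is a subset of a bound for the pairs, so the power set of that bound contains
  all graphs.\<close>

lemma elts_vexp: "elts (vexp B A) = {graph A f | f. f \<in> elts A \<rightarrow> elts B}"
proof -
  obtain c where c: "\<forall>x\<in>elts A. \<forall>y\<in>elts B. opair x y \<in> elts c" using ex_opairs by blast
  obtain p where p: "elts p = {x. elts x \<subseteq> elts c}" using elts_power by blast
  show ?thesis unfolding vexp_def
  proof (intro elts_vset[of _ p] subsetI)
    fix g assume "g \<in> {graph A f | f. f \<in> elts A \<rightarrow> elts B}"
    then obtain f where "g = graph A f" "f \<in> elts A \<rightarrow> elts B" by blast
    with c show "g \<in> elts p" by (auto simp: p elts_graph)
  qed
qed

section \<open>Evaluation and composition of graphs\<close>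

text \<open>Recovers a HOL function from its coded graph, up to values off the domain. Equations
  between coded functions can then be checked point by point.\<close>

definition vapp :: "'v::set_universe \<Rightarrow> 'v \<Rightarrow> 'v" where
  "vapp g x = (THE y. opair x y \<in> elts g)"

lemma graph_vexp: "f \<in> elts A \<rightarrow> elts B \<Longrightarrow> graph A f \<in> elts (vexp B A)"
  by (auto simp: elts_vexp)

lemma graph_cong: "(\<And>x. x \<in> elts A \<Longrightarrow> f x = g x) \<Longrightarrow> graph A f = graph A g"
  unfolding graph_def by (simp cong: image_cong)

lemma vapp_graph: "f \<in> elts A \<rightarrow> elts B \<Longrightarrow> x \<in> elts A \<Longrightarrow> vapp (graph A f) x = f x"
  unfolding vapp_def by (rule the_equality) (auto simp: elts_graph)

lemma
  assumes "g \<in> elts (vexp B A)"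
  shows vapp_in: "x \<in> elts A \<Longrightarrow> vapp g x \<in> elts B"
    and graph_vapp: "graph A (vapp g) = g"
proof -
  obtain f where f: "g = graph A f" "f \<in> elts A \<rightarrow> elts B" using assms by (auto simp: elts_vexp)
  then show "x \<in> elts A \<Longrightarrow> vapp g x \<in> elts B" by (auto simp: vapp_graph)
  show "graph A (vapp g) = g" using f by (auto intro!: graph_cong simp: vapp_graph)
qed

text \<open>A graph does not record its codomain, so only the domains have to agree and
  \<open>B\<close> and \<open>B'\<close> may differ.\<close>

lemma vexp_eqI:
  assumes "f \<in> elts (vexp B A)" "g \<in> elts (vexp B' A)"
    and "\<And>x. x \<in> elts A \<Longrightarrow> vapp f x = vapp g x"
  shows "f = g"
  using graph_cong[of A "vapp f" "vapp g"] assms by (simp add: graph_vapp)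

lemma vcomp_graph:
  assumes "f \<in> elts A \<rightarrow> elts B" "g \<in> elts B \<rightarrow> elts E"
  shows "vcomp (graph B g) (graph A f) = graph A (\<lambda>x. g (f x))"
proof -
  have "{opair x z |x y z. opair x y \<in> elts (graph A f) \<and> opair y z \<in> elts (graph B g)}
      = (\<lambda>x. opair x (g (f x))) ` elts A"
    using assms by (auto simp: elts_graph image_iff Pi_iff)
  then show ?thesis unfolding vcomp_def by (simp only: graph_def)
qed

lemma
  assumes "f \<in> elts (vexp B A)" "g \<in> elts (vexp E B)"
  shows vcomp_vexp: "vcomp g f \<in> elts (vexp E A)"
    and vapp_vcomp: "x \<in> elts A \<Longrightarrow> vapp (vcomp g f) x = vapp g (vapp f x)"
proof -
  have *: "vcomp g f = graph A (\<lambda>x. vapp g (vapp f x))"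
    using vcomp_graph[of "vapp f" A B "vapp g" E] assms by (simp add: graph_vapp vapp_in)
  show "vcomp g f \<in> elts (vexp E A)"
    unfolding * using assms by (auto intro!: graph_vexp intro: vapp_in)
  show "x \<in> elts A \<Longrightarrow> vapp (vcomp g f) x = vapp g (vapp f x)"
    unfolding * using assms by (intro vapp_graph[of _ _ E]) (auto intro: vapp_in)
qed

lemma graph_id_vexp: "graph A (\<lambda>x. x) \<in> elts (vexp A A)"
  by (auto intro: graph_vexp)

lemma vapp_id: "x \<in> elts A \<Longrightarrow> vapp (graph A (\<lambda>x. x)) x = x"
  by (rule vapp_graph[of _ _ A]) auto

lemma vcomp_assoc:
  assumes "f \<in> elts (vexp B A)" "g \<in> elts (vexp E B)" "h \<in> elts (vexp G E)"
  shows "vcomp h (vcomp g f) = vcomp (vcomp h g) f"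
proof (rule vexp_eqI)
  note gf = vcomp_vexp[OF assms(1,2)] and hg = vcomp_vexp[OF assms(2,3)]
  show "vcomp h (vcomp g f) \<in> elts (vexp G A)" "vcomp (vcomp h g) f \<in> elts (vexp G A)"
    using vcomp_vexp[OF gf assms(3)] vcomp_vexp[OF assms(1) hg] .
  show "vapp (vcomp h (vcomp g f)) x = vapp (vcomp (vcomp h g) f) x" if "x \<in> elts A" for x
    using that
    by (simp add: vapp_vcomp[OF gf assms(3)] vapp_vcomp[OF assms(1) hg] vapp_vcomp[OF assms(1,2)]
        vapp_vcomp[OF assms(2,3)] vapp_in[OF assms(1)])
qed

lemma
  assumes "f \<in> elts (vexp B A)"
  shows vcomp_id_right: "vcomp f (graph A (\<lambda>x. x)) = f"
    and vcomp_id_left: "vcomp (graph B (\<lambda>x. x)) f = f"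
proof -
  note r = vcomp_vexp[OF graph_id_vexp assms] and l = vcomp_vexp[OF assms graph_id_vexp]
  show "vcomp f (graph A (\<lambda>x. x)) = f" "vcomp (graph B (\<lambda>x. x)) f = f"
    by (rule vexp_eqI[OF r assms] vexp_eqI[OF l assms], simp add: vapp_vcomp[OF graph_id_vexp assms]
        vapp_vcomp[OF assms graph_id_vexp] vapp_id vapp_in[OF assms])+
qed


section \<open>Categories\<close>

lemma hom_iff: "f \<in> hom K A B \<longleftrightarrow> f \<in> Ar K \<and> Dom K f = A \<and> Cod K f = B"
  by (auto simp: hom_def)

lemma Comp_hom:
  "is_category K \<Longrightarrow> f \<in> hom K A B \<Longrightarrow> g \<in> hom K B E \<Longrightarrow> Comp K g f \<in> hom K A E"
  unfolding is_category_def hom_iff by metis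

lemma Comp_assoc:
  "is_category K \<Longrightarrow> f \<in> hom K A B \<Longrightarrow> g \<in> hom K B E \<Longrightarrow> h \<in> hom K E G \<Longrightarrow>
   Comp K h (Comp K g f) = Comp K (Comp K h g) f"
  unfolding is_category_def hom_iff by metis

lemma Comp_Ident_right: "is_category K \<Longrightarrow> f \<in> hom K A B \<Longrightarrow> Comp K f (Ident K A) = f"
  unfolding is_category_def hom_iff by metis

lemma Comp_Ident_left: "is_category K \<Longrightarrow> f \<in> hom K A B \<Longrightarrow> Comp K (Ident K B) f = f"
  unfolding is_category_def hom_iff by metis

lemma Ident_hom: "is_category K \<Longrightarrow> A \<in> Ob K \<Longrightarrow> Ident K A \<in> hom K A A"
  unfolding is_category_def by metis

lemma hom_Ob: "is_category K \<Longrightarrow> f \<in> hom K A B \<Longrightarrow> A \<in> Ob K \<and> B \<in> Ob K"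
  unfolding is_category_def hom_iff by metis

lemma Ar_Dom_Ob: "is_category K \<Longrightarrow> f \<in> Ar K \<Longrightarrow> Dom K f \<in> Ob K"
  and Ar_Cod_Ob: "is_category K \<Longrightarrow> f \<in> Ar K \<Longrightarrow> Cod K f \<in> Ob K"
  unfolding is_category_def by metis+

text \<open>Sources and targets are variables here, so composability is carried by
  \<open>hom\<close> and no equations between \<open>Dom\<close> and \<open>Cod\<close> have to be
  rewritten in the applications.\<close>

lemma is_categoryI:
  assumes "\<And>f. f \<in> Ar K \<Longrightarrow> Dom K f \<in> Ob K \<and> Cod K f \<in> Ob K"
    and "\<And>A. A \<in> Ob K \<Longrightarrow> Ident K A \<in> hom K A A"
    and "\<And>A B E f g. f \<in> hom K A B \<Longrightarrow> g \<in> hom K B E \<Longrightarrow> Comp K g f \<in> hom K A E"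
    and "\<And>A B f. f \<in> hom K A B \<Longrightarrow> Comp K f (Ident K A) = f"
    and "\<And>A B f. f \<in> hom K A B \<Longrightarrow> Comp K (Ident K B) f = f"
    and "\<And>A B E G f g h. f \<in> hom K A B \<Longrightarrow> g \<in> hom K B E \<Longrightarrow> h \<in> hom K E G \<Longrightarrow>
      Comp K h (Comp K g f) = Comp K (Comp K h g) f"
  shows "is_category K"
  unfolding is_category_def
  using assms(1-2) assms(3)[unfolded hom_iff] assms(4-6)[unfolded hom_iff]
  by (auto simp: hom_iff)

section \<open>Opposite categories\<close>

lemma op_cat_simps [simp]:
  "Ob (op_cat K) = Ob K" "Ar (op_cat K) = Ar K" "Dom (op_cat K) = Cod K" "Cod (op_cat K) = Dom K"
  "Ident (op_cat K) = Ident K" "Comp (op_cat K) = (\<lambda>g f. Comp K f g)"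
  by (simp_all add: op_cat_def)

lemma hom_op_cat: "hom (op_cat K) A B = hom K B A"
  by (auto simp: hom_iff)

lemma is_category_op_cat: "is_category K \<Longrightarrow> is_category (op_cat K)"
  by (rule is_categoryI)
    (auto simp: hom_op_cat Comp_Ident_left Comp_Ident_right Ar_Dom_Ob Ar_Cod_Ob
      intro: Ident_hom Comp_hom Comp_assoc[symmetric])

section \<open>Functors, natural transformations and functor categories\<close>

lemma Fun_cat_simps [simp]:
  "Ob (Fun_cat K L) = {F. is_functor K L F}"
  "Ar (Fun_cat K L) = {t. is_nat_trans K L (src t) (trg t) (und t)}"
  "Dom (Fun_cat K L) = src" "Cod (Fun_cat K L) = trg"
  "Ident (Fun_cat K L) F = Arrow F (\<lambda>A\<in>Ob K. Ident L (FOb F A)) F"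
  "Comp (Fun_cat K L) t s = Arrow (src s) (\<lambda>A\<in>Ob K. Comp L (und t A) (und s A)) (trg t)"
  by (simp_all add: Fun_cat_def)

lemma is_functor_cats: "is_functor K L F \<Longrightarrow> is_category K" "is_functor K L F \<Longrightarrow> is_category L"
  by (simp_all add: is_functor_def)

lemma is_functor_FOb: "is_functor K L F \<Longrightarrow> A \<in> Ob K \<Longrightarrow> FOb F A \<in> Ob L"
  by (auto simp: is_functor_def)

lemma is_functor_FAr: "is_functor K L F \<Longrightarrow> f \<in> hom K A B \<Longrightarrow> FAr F f \<in> hom L (FOb F A) (FOb F B)"
  by (auto simp: is_functor_def hom_iff)

lemma is_functor_Ident: "is_functor K L F \<Longrightarrow> A \<in> Ob K \<Longrightarrow> FAr F (Ident K A) = Ident L (FOb F A)"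
  by (auto simp: is_functor_def)

lemma is_functor_Comp: "is_functor K L F \<Longrightarrow> f \<in> hom K A B \<Longrightarrow> g \<in> hom K B E \<Longrightarrow>
    FAr F (Comp K g f) = Comp L (FAr F g) (FAr F f)"
  by (auto simp: is_functor_def hom_iff)

lemma is_functorI:
  assumes "is_category K" "is_category L"
    and "FOb F \<in> extensional (Ob K)" "FAr F \<in> extensional (Ar K)"
    and "\<And>A. A \<in> Ob K \<Longrightarrow> FOb F A \<in> Ob L"
    and "\<And>A B f. f \<in> hom K A B \<Longrightarrow> FAr F f \<in> hom L (FOb F A) (FOb F B)"
    and "\<And>A. A \<in> Ob K \<Longrightarrow> FAr F (Ident K A) = Ident L (FOb F A)"
    and "\<And>A B E f g. f \<in> hom K A B \<Longrightarrow> g \<in> hom K B E \<Longrightarrow>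
      FAr F (Comp K g f) = Comp L (FAr F g) (FAr F f)"
  shows "is_functor K L F"
  unfolding is_functor_def using assms by (auto simp: hom_iff PiE_def)

lemma is_nat_trans_functors:
  "is_nat_trans K L F G \<eta> \<Longrightarrow> is_functor K L F" "is_nat_trans K L F G \<eta> \<Longrightarrow> is_functor K L G"
  by (simp_all add: is_nat_trans_def)

lemma is_nat_trans_hom: "is_nat_trans K L F G \<eta> \<Longrightarrow> A \<in> Ob K \<Longrightarrow> \<eta> A \<in> hom L (FOb F A) (FOb G A)"
  by (simp add: is_nat_trans_def)

lemma is_nat_trans_nat: "is_nat_trans K L F G \<eta> \<Longrightarrow> f \<in> hom K A B \<Longrightarrow>
    Comp L (\<eta> B) (FAr F f) = Comp L (FAr G f) (\<eta> A)"
  by (auto simp: is_nat_trans_def hom_iff)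

lemma is_nat_trans_extensional: "is_nat_trans K L F G \<eta> \<Longrightarrow> \<eta> \<in> extensional (Ob K)"
  by (simp add: is_nat_trans_def)

lemma is_nat_transI:
  assumes "is_functor K L F" "is_functor K L G" "\<eta> \<in> extensional (Ob K)"
    and "\<And>A. A \<in> Ob K \<Longrightarrow> \<eta> A \<in> hom L (FOb F A) (FOb G A)"
    and "\<And>A B f. f \<in> hom K A B \<Longrightarrow> Comp L (\<eta> B) (FAr F f) = Comp L (FAr G f) (\<eta> A)"
  shows "is_nat_trans K L F G \<eta>"
  unfolding is_nat_trans_def using assms by (auto simp: hom_iff)

lemma hom_Fun_cat:
  "t \<in> hom (Fun_cat K L) F G \<longleftrightarrow> src t = F \<and> trg t = G \<and> is_nat_trans K L F G (und t)"
  by (auto simp: hom_iff)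

lemma is_nat_trans_Ident:
  assumes F: "is_functor K L F"
  shows "is_nat_trans K L F F (\<lambda>A\<in>Ob K. Ident L (FOb F A))"
proof (rule is_nat_transI[OF F F])
  note cats = is_functor_cats[OF F]
  show "(\<lambda>A\<in>Ob K. Ident L (FOb F A)) A \<in> hom L (FOb F A) (FOb F A)" if "A \<in> Ob K" for A
    using that F cats by (simp add: is_functor_FOb Ident_hom)
  show "Comp L ((\<lambda>A\<in>Ob K. Ident L (FOb F A)) B) (FAr F f) = Comp L (FAr F f) ((\<lambda>A\<in>Ob K. Ident L (FOb F A)) A)"
    if "f \<in> hom K A B" for f A B
    using hom_Ob[OF cats(1) that] is_functor_FAr[OF F that]
    by (simp add: Comp_Ident_left[OF cats(2)] Comp_Ident_right[OF cats(2)])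
qed simp

lemma is_nat_trans_Comp:
  assumes s: "is_nat_trans K L F G \<sigma>" and t: "is_nat_trans K L G H \<tau>"
  shows "is_nat_trans K L F H (\<lambda>A\<in>Ob K. Comp L (\<tau> A) (\<sigma> A))"
proof (rule is_nat_transI)
  show F: "is_functor K L F" and H: "is_functor K L H"
    using s t by (simp_all add: is_nat_trans_functors)
  have G: "is_functor K L G" using s by (simp add: is_nat_trans_functors)
  note cats = is_functor_cats[OF F]
  note homs = is_nat_trans_hom[OF s] is_nat_trans_hom[OF t]
  show "(\<lambda>A\<in>Ob K. Comp L (\<tau> A) (\<sigma> A)) A \<in> hom L (FOb F A) (FOb H A)" if "A \<in> Ob K" for A
    using that by (simp add: Comp_hom[OF cats(2) homs])
  show "Comp L ((\<lambda>A\<in>Ob K. Comp L (\<tau> A) (\<sigma> A)) B) (FAr F f) =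
        Comp L (FAr H f) ((\<lambda>A\<in>Ob K. Comp L (\<tau> A) (\<sigma> A)) A)" if f: "f \<in> hom K A B" for f A B
  proof -
    have AB: "A \<in> Ob K" "B \<in> Ob K" using hom_Ob[OF cats(1) f] by auto
    note fs = is_functor_FAr[OF F f] is_functor_FAr[OF G f] is_functor_FAr[OF H f]
    have "Comp L (Comp L (\<tau> B) (\<sigma> B)) (FAr F f) = Comp L (\<tau> B) (Comp L (FAr G f) (\<sigma> A))"
      by (simp add: Comp_assoc[OF cats(2) fs(1) homs(1,2)] AB is_nat_trans_nat[OF s f, symmetric])
    also have "\<dots> = Comp L (Comp L (FAr H f) (\<tau> A)) (\<sigma> A)"
      by (simp add: Comp_assoc[OF cats(2) homs(1) fs(2) homs(2)] AB is_nat_trans_nat[OF t f, symmetric])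
    also have "\<dots> = Comp L (FAr H f) (Comp L (\<tau> A) (\<sigma> A))"
      by (simp add: Comp_assoc[OF cats(2) homs(1,2) fs(3)] AB)
    finally show ?thesis using AB by simp
  qed
qed simp

text \<open>That \<open>K\<close> and \<open>L\<close> are categories is read off from any functor
  between them. If one of them is not, \<open>Fun_cat K L\<close> has neither objects nor arrows and
  the axioms hold vacuously.\<close>

lemma is_category_Fun_cat: "is_category (Fun_cat K L)"
proof (rule is_categoryI)
  fix F G H M s t r
  assume s: "s \<in> hom (Fun_cat K L) F G"
  then have sn: "is_nat_trans K L F G (und s)" and s': "s = Arrow F (und s) G"
    by (auto simp: hom_Fun_cat arrow.expand)
  note cats = is_functor_cats[OF is_nat_trans_functors(1)[OF sn]]
  note ext = extensional_arb[OF is_nat_trans_extensional[OF sn]]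
  note sh = is_nat_trans_hom[OF sn]
  \<comment> \<open>These are equations of total HOL functions. Off \<open>Ob K\<close> both sides
    are \<open>undefined\<close>, because the components of a transformation are
    extensional.\<close>
  have "(\<lambda>A\<in>Ob K. Comp L (und s A) (Ident L (FOb F A))) = und s"
    "(\<lambda>A\<in>Ob K. Comp L (Ident L (FOb G A)) (und s A)) = und s"
    using Comp_Ident_right[OF cats(2) sh] Comp_Ident_left[OF cats(2) sh]
    by (auto simp: fun_eq_iff ext)
  then show "Comp (Fun_cat K L) s (Ident (Fun_cat K L) F) = s"
    "Comp (Fun_cat K L) (Ident (Fun_cat K L) G) s = s"
    using s by (auto simp: hom_Fun_cat arrow.expand cong: restrict_cong)
  assume t: "t \<in> hom (Fun_cat K L) G H"
  then show "Comp (Fun_cat K L) t s \<in> hom (Fun_cat K L) F H"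
    using s by (auto simp: hom_Fun_cat intro: is_nat_trans_Comp)
  assume r: "r \<in> hom (Fun_cat K L) H M"
  have "Comp L (und r A) (Comp L (und t A) (und s A)) = Comp L (Comp L (und r A) (und t A)) (und s A)"
    if "A \<in> Ob K" for A
    using s t r that by (intro Comp_assoc[OF cats(2)]) (auto simp: hom_Fun_cat intro: is_nat_trans_hom)
  then show "Comp (Fun_cat K L) r (Comp (Fun_cat K L) t s) = Comp (Fun_cat K L) (Comp (Fun_cat K L) r t) s"
    by (auto intro: restrict_ext)
qed (auto simp: is_nat_trans_functors hom_Fun_cat intro: is_nat_trans_Ident)


section \<open>Subobjects and images\<close>

lemma mono_le_refl: "is_category K \<Longrightarrow> m \<in> Ar K \<Longrightarrow> mono_le K m m"
  unfolding mono_le_def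
  by (auto intro!: bexI[of _ "Ident K (Dom K m)"] simp: Ident_hom Ar_Dom_Ob
      Comp_Ident_right[where B = "Cod K m"] hom_iff[of m])

lemma mono_leI: "is_category K \<Longrightarrow> n \<in> hom K B E \<Longrightarrow> s \<in> hom K A B \<Longrightarrow> mono_le K (Comp K n s) n"
  unfolding mono_le_def using Comp_hom[of K s A B n E] by (auto simp: hom_iff)

lemma mono_leE:
  assumes "mono_le K m n" "n \<in> Ar K"
  obtains s where "s \<in> hom K (Dom K m) (Dom K n)" "n \<in> hom K (Dom K n) (Cod K n)" "m = Comp K n s"
    "Cod K m = Cod K n"
  using assms by (auto simp: mono_le_def hom_iff)

lemma mono_le_trans:
  assumes "is_category K" "mono_le K l m" "mono_le K m n" "m \<in> Ar K" "n \<in> Ar K"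
  shows "mono_le K l n"
proof -
  obtain s where s: "s \<in> hom K (Dom K l) (Dom K m)" "l = Comp K m s" using mono_leE[OF assms(2,4)] .
  obtain t where t: "t \<in> hom K (Dom K m) (Dom K n)" "m = Comp K n t" "n \<in> hom K (Dom K n) (Cod K n)"
    using mono_leE[OF assms(3,5)] .
  have "l = Comp K n (Comp K t s)" using s t Comp_assoc[OF assms(1) s(1) t(1,3)] by simp
  then show ?thesis using mono_leI[OF assms(1) t(3) Comp_hom[OF assms(1) s(1) t(1)]] by simp
qed

text \<open>From \<open>m = n s\<close> follows \<open>k m = (k n) s\<close>. As \<open>k\<close>
  may fail to be monic, the composites are in general mere arrows; this is why the preorder is
  developed beyond monomorphisms.\<close>

lemma mono_le_Comp:
  assumes "is_category K" "mono_le K m n" "n \<in> hom K A B" "k \<in> hom K B E"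
  shows "mono_le K (Comp K k m) (Comp K k n)"
proof -
  have "n \<in> Ar K" and n: "Dom K n = A" using assms(3) by (auto simp: hom_iff)
  from mono_leE[OF assms(2) this(1)] obtain s
    where s: "s \<in> hom K (Dom K m) A" "m = Comp K n s" unfolding n by blast
  show ?thesis unfolding s(2) Comp_assoc[OF assms(1) s(1) assms(3,4)]
    by (rule mono_leI[OF assms(1) Comp_hom[OF assms(1,3,4)] s(1)])
qed

lemma is_mono_Ar: "is_mono K m \<Longrightarrow> m \<in> Ar K"
  by (simp add: is_mono_def)

lemma is_monoD:
  "is_mono K m \<Longrightarrow> m \<in> hom K A B \<Longrightarrow> f \<in> hom K X A \<Longrightarrow> g \<in> hom K X A \<Longrightarrow>
   Comp K m f = Comp K m g \<Longrightarrow> f = g"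
  by (simp add: is_mono_def hom_iff)

lemma self_in_subobject: "is_category K \<Longrightarrow> is_mono K m \<Longrightarrow> m \<in> subobject K m"
  by (simp add: subobject_def mono_le_refl is_mono_Ar)

lemma subobject_eq:
  assumes "is_category K" "is_mono K m" "is_mono K n" "mono_le K m n" "mono_le K n m"
  shows "subobject K m = subobject K n"
  unfolding subobject_def
  using mono_le_trans[OF assms(1) _ assms(4)] mono_le_trans[OF assms(1) assms(4)]
    mono_le_trans[OF assms(1) _ assms(5)] mono_le_trans[OF assms(1) assms(5)] assms(2,3)
  by (auto simp: is_mono_Ar)

text \<open>Every member of a class can serve as its representative. This allows passing from the
  member chosen by \<open>SOME\<close> to a convenient one.\<close>

lemma subobject_member:
  assumes "is_category K" "S \<in> subobjects K B" "F \<in> S"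
  shows "is_mono K F" "Cod K F = B" "S = subobject K F"
proof -
  obtain m where m: "S = subobject K m" "is_mono K m" "Cod K m = B"
    using assms(2) by (auto simp: subobjects_def)
  with assms(3) have F: "is_mono K F" "mono_le K m F" "mono_le K F m" by (auto simp: subobject_def)
  then show "is_mono K F" "Cod K F = B" using m(3) by (auto simp: mono_le_def)
  show "S = subobject K F" unfolding m(1) using assms(1) m(2) F by (intro subobject_eq)
qed

lemma subobjects_nonempty: "is_category K \<Longrightarrow> S \<in> subobjects K B \<Longrightarrow> S \<noteq> {}"
  by (auto simp: subobjects_def dest: self_in_subobject)

text \<open>The definition asks for some pair of representatives. Any two members of a class factor
  through each other, so transitivity transports the relation to the given pair.\<close>

lemma subobject_le_iff:
  assumes "is_category K" "is_mono K m" "is_mono K n"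
  shows "subobject_le K (subobject K m) (subobject K n) \<longleftrightarrow> mono_le K m n"
proof
  assume "subobject_le K (subobject K m) (subobject K n)"
  then obtain m' n' where "is_mono K m'" "mono_le K m m'" "mono_le K m' n'" "is_mono K n'" "mono_le K n' n"
    by (auto simp: subobject_le_def subobject_def)
  note m'n' = this
  have "mono_le K m n'"
    using mono_le_trans[OF assms(1) m'n'(2,3)] m'n'(1,4) by (simp add: is_mono_Ar)
  then show "mono_le K m n"
    using mono_le_trans[OF assms(1) _ m'n'(5)] m'n'(4) assms(3) by (simp add: is_mono_Ar)
qed (use self_in_subobject[OF assms(1,2)] self_in_subobject[OF assms(1,3)] in
    \<open>auto simp: subobject_le_def\<close>)

section \<open>Images as least factorizations\<close>

text \<open>A factorization of \<open>h\<close> through a monomorphism \<open>n\<close> is an image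
  candidate, and the universal property applied to it factors \<open>\<psi>\<close> through
  \<open>n\<close>.\<close>

lemma image_triple_least:
  assumes "image_triple K h V \<theta> \<psi>" "is_category K" "is_mono K n" "mono_le K h n"
  shows "mono_le K \<psi> n"
proof -
  have n: "n \<in> Ar K" using assms(3) by (rule is_mono_Ar)
  from mono_leE[OF assms(4) this] obtain s
    where s: "s \<in> hom K (Dom K h) (Dom K n)" "h = Comp K n s" "Cod K h = Cod K n" by blast
  then have "image_candidate K h (Dom K n) s n"
    unfolding image_candidate_def using assms(2,3) n by (auto simp: hom_iff Ar_Dom_Ob)
  then have "\<exists>!u. u \<in> hom K V (Dom K n) \<and> Comp K n u = \<psi>"
    using assms(1) unfolding image_triple_def by blast
  then obtain u where "u \<in> hom K V (Dom K n)" "Comp K n u = \<psi>" by blast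
  then show ?thesis
    using assms(1) s(3) unfolding mono_le_def image_triple_def image_candidate_def by (auto simp: hom_iff)
qed

lemma image_triple_mono_le:
  assumes "image_triple K h V \<theta> \<psi>" "is_category K"
  shows "is_mono K \<psi>" "mono_le K h \<psi>"
proof -
  have *: "is_mono K \<psi>" "\<theta> \<in> hom K (Dom K h) V" "\<psi> \<in> hom K V (Cod K h)" "h = Comp K \<psi> \<theta>"
    using assms(1) by (auto simp: image_triple_def image_candidate_def)
  then show "is_mono K \<psi>" "mono_le K h \<psi>" using mono_leI[OF assms(2) *(3,2)] by auto
qed

text \<open>The description in \<open>im\<close> is proper: the monomorphisms of two image triples
  are both least, hence factor through each other and have the same class.\<close>

lemma im_eq:
  assumes "image_triple K h V \<theta> \<psi>" "is_category K"
  shows "im K h = subobject K \<psi>"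
  unfolding im_def
proof (rule the_equality)
  fix S assume "\<exists>V' \<theta>' \<psi>'. image_triple K h V' \<theta>' \<psi>' \<and> S = subobject K \<psi>'"
  then obtain V' \<theta>' \<psi>' where *: "image_triple K h V' \<theta>' \<psi>'" and S: "S = subobject K \<psi>'" by blast
  show "S = subobject K \<psi>" unfolding S
    using image_triple_mono_le[OF * assms(2)] image_triple_mono_le[OF assms]
      image_triple_least[OF * assms(2)] image_triple_least[OF assms]
    by (intro subobject_eq assms(2))
qed (use assms in blast)

text \<open>\<open>mono_le K h n\<close> says that \<open>h\<close> factors through \<open>n\<close>; here \<open>h\<close> need not be a monomorphism.\<close>

lemma im_le_iff:
  assumes "is_category K" "has_image K h" "is_mono K n"
  shows "subobject_le K (im K h) (subobject K n) \<longleftrightarrow> mono_le K h n"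
proof -
  obtain V \<theta> \<psi> where *: "image_triple K h V \<theta> \<psi>" using assms(2) by (auto simp: has_image_def)
  note mono = image_triple_mono_le[OF * assms(1)]
  \<comment> \<open>One direction is leastness of \<open>\<psi>\<close>; the other composes with the
    factorization of \<open>h\<close> through \<open>\<psi>\<close>.\<close>
  have "mono_le K \<psi> n \<longleftrightarrow> mono_le K h n"
    using image_triple_least[OF * assms(1,3)] mono_le_trans[OF assms(1) mono(2), of n] mono(1) assms(3)
    by (auto simp: is_mono_Ar)
  then show ?thesis
    unfolding im_eq[OF * assms(1)] subobject_le_iff[OF assms(1) mono(1) assms(3)] .
qed


section \<open>The category of structures\<close>

lemma sig_at_simps [simp]:
  "N \<in> Ob I \<Longrightarrow> FOb (sig_at I \<rho> A) N = FOb (FOb \<rho> N) A"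
  "\<nu> \<in> Ar I \<Longrightarrow> FAr (sig_at I \<rho> A) \<nu> = und (FAr \<rho> \<nu>) A"
  by (simp_all add: sig_at_def)

section \<open>Presignatures at a fixed object and at a fixed arrow\<close>

context
  fixes I :: "('io, 'ia) category" and C :: "('co, 'ca) category" and D :: "('do, 'da) category"
    and \<rho> :: "('io, 'ia, 'co, 'ca, 'do, 'da) presig"
  assumes presig: "presignature I C D \<rho>"
begin

lemma presig_cats: "is_category I" "is_category C" "is_category D"
  using presig by (auto simp: presignature_def)

lemma presig_functor: "is_functor I (Fun_cat C D) \<rho>"
  using presig by (auto simp: presignature_def)

lemma presig_FOb: "N \<in> Ob I \<Longrightarrow> is_functor C D (FOb \<rho> N)"
  using is_functor_FOb[OF presig_functor] by simp

lemma presig_FAr: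
  "\<nu> \<in> hom I N M \<Longrightarrow> is_nat_trans C D (FOb \<rho> N) (FOb \<rho> M) (und (FAr \<rho> \<nu>))"
  using is_functor_FAr[OF presig_functor] by (auto simp: hom_Fun_cat)

text \<open>Evaluation at \<open>A\<close> is a functor from \<open>Fun_cat C D\<close> to
  \<open>D\<close>, and \<open>\<rho>\<^sub>A\<close> is its composite with
  \<open>\<rho>\<close>.\<close>

lemma is_functor_sig_at:
  assumes A: "A \<in> Ob C"
  shows "is_functor I D (sig_at I \<rho> A)"
proof (rule is_functorI)
  show "is_category I" "is_category D" by (fact presig_cats)+
  show "FOb (sig_at I \<rho> A) \<in> extensional (Ob I)" "FAr (sig_at I \<rho> A) \<in> extensional (Ar I)"
    by (simp_all add: sig_at_def)
  show "FOb (sig_at I \<rho> A) N \<in> Ob D" if "N \<in> Ob I" for N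
    using that is_functor_FOb[OF presig_FOb A] by simp
  show "FAr (sig_at I \<rho> A) \<nu> \<in> hom D (FOb (sig_at I \<rho> A) N) (FOb (sig_at I \<rho> A) M)"
    if "\<nu> \<in> hom I N M" for \<nu> N M
    using that hom_Ob[OF presig_cats(1) that] is_nat_trans_hom[OF presig_FAr[OF that] A]
    by (auto simp: hom_iff[of \<nu>])
  show "FAr (sig_at I \<rho> A) (Ident I N) = Ident D (FOb (sig_at I \<rho> A) N)" if "N \<in> Ob I" for N
    using that A Ident_hom[OF presig_cats(1) that]
    by (simp add: hom_iff[of "Ident I N"] is_functor_Ident[OF presig_functor that])
  show "FAr (sig_at I \<rho> A) (Comp I \<mu> \<nu>) = Comp D (FAr (sig_at I \<rho> A) \<mu>) (FAr (sig_at I \<rho> A) \<nu>)"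
    if \<nu>: "\<nu> \<in> hom I N M" and \<mu>: "\<mu> \<in> hom I M L" for \<nu> \<mu> N M L
    using A \<nu> \<mu> Comp_hom[OF presig_cats(1) \<nu> \<mu>]
    by (simp add: hom_iff[where K = I] is_functor_Comp[OF presig_functor \<nu> \<mu>])
qed

text \<open>The naturality square of \<open>\<rho>\<^sub>h\<close> at \<open>\<nu>\<close> is the
  naturality square of the transformation \<open>\<rho>(\<nu>)\<close> at \<open>h\<close>, read in
  the other direction.\<close>

lemma sig_map_hom:
  assumes h: "h \<in> hom C A B"
  shows "sig_map I C \<rho> h \<in> hom (Fun_cat I D) (sig_at I \<rho> A) (sig_at I \<rho> B)"
proof -
  have AB: "A \<in> Ob C" "B \<in> Ob C" and dc: "Dom C h = A" "Cod C h = B"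
    using hom_Ob[OF presig_cats(2) h] h by (auto simp: hom_iff)
  have "is_nat_trans I D (sig_at I \<rho> A) (sig_at I \<rho> B) (\<lambda>N\<in>Ob I. FAr (FOb \<rho> N) h)"
  proof (rule is_nat_transI)
    show "(\<lambda>N\<in>Ob I. FAr (FOb \<rho> N) h) N \<in> hom D (FOb (sig_at I \<rho> A) N) (FOb (sig_at I \<rho> B) N)"
      if "N \<in> Ob I" for N
      using that is_functor_FAr[OF presig_FOb h] by simp
    show "Comp D ((\<lambda>N\<in>Ob I. FAr (FOb \<rho> N) h) M) (FAr (sig_at I \<rho> A) \<nu>) =
          Comp D (FAr (sig_at I \<rho> B) \<nu>) ((\<lambda>N\<in>Ob I. FAr (FOb \<rho> N) h) N)"
      if "\<nu> \<in> hom I N M" for \<nu> N M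
      using that hom_Ob[OF presig_cats(1) that] is_nat_trans_nat[OF presig_FAr[OF that] h]
      by (simp add: hom_iff[of \<nu>])
  qed (simp_all add: is_functor_sig_at AB)
  then show ?thesis by (simp add: hom_Fun_cat sig_map_def dc)
qed

lemma sig_map_Ident:
  assumes A: "A \<in> Ob C"
  shows "sig_map I C \<rho> (Ident C A) = Ident (Fun_cat I D) (sig_at I \<rho> A)"
  using Ident_hom[OF presig_cats(2) A]
  by (auto simp: sig_map_def hom_iff is_functor_Ident[OF presig_FOb A] intro!: restrict_ext)

lemma sig_map_Comp:
  assumes h: "h \<in> hom C A B" and k: "k \<in> hom C B E"
  shows "sig_map I C \<rho> (Comp C k h) = Comp (Fun_cat I D) (sig_map I C \<rho> k) (sig_map I C \<rho> h)"
  using Comp_hom[OF presig_cats(2) h k] h k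
  by (auto simp: sig_map_def hom_iff is_functor_Comp[OF presig_FOb h k] intro!: restrict_ext)

end

section \<open>Structures and their morphisms\<close>

lemma structuresD:
  assumes "X \<in> structures I C D \<rho>"
  shows "fst X \<in> Ob C" "snd X \<in> subobjects (Fun_cat I D) (sig_at I \<rho> (fst X))"
  using assms by (auto simp: structures_def)

lemma Struct_simps [simp]:
  "Ob (Struct I C D \<rho>) = structures I C D \<rho>"
  "Dom (Struct I C D \<rho>) = src" "Cod (Struct I C D \<rho>) = trg"
  "Ident (Struct I C D \<rho>) X = Arrow X (Ident C (fst X)) X"
  "Comp (Struct I C D \<rho>) g f = Arrow (src f) (Comp C (und g) (und f)) (trg g)"
  by (simp_all add: Struct_def)

lemma Struct_Ar_D:
  assumes "f \<in> Ar (Struct I C D \<rho>)"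
  shows "src f \<in> structures I C D \<rho>" "trg f \<in> structures I C D \<rho>"
    "und f \<in> hom C (fst (src f)) (fst (trg f))"
  using assms by (auto simp: Struct_def)

context
  fixes I :: "('io, 'ia) category" and C :: "('co, 'ca) category" and D :: "('do, 'da) category"
    and \<rho> :: "('io, 'ia, 'co, 'ca, 'do, 'da) presig"
  assumes sig: "signature I C D \<rho>"
begin

lemma signature_presignature: "presignature I C D \<rho>"
  using sig by (simp add: signature_def)

text \<open>\<open>im_le_iff\<close> trades the direct image for a factorization of
  \<open>\<rho>\<^sub>h F'\<close>, where \<open>F'\<close> is the chosen representative. Since
  \<open>F\<close> and \<open>F'\<close> factor through each other, so do their composites with
  \<open>\<rho>\<^sub>h\<close>, and \<open>F'\<close> may be replaced by \<open>F\<close>.\<close>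

lemma Struct_Ar_iff:
  assumes X: "X \<in> structures I C D \<rho>" and Y: "Y \<in> structures I C D \<rho>"
    and F: "F \<in> snd X" and G: "G \<in> snd Y" and h: "h \<in> hom C (fst X) (fst Y)"
  shows "Arrow X h Y \<in> Ar (Struct I C D \<rho>) \<longleftrightarrow>
    mono_le (Fun_cat I D) (Comp (Fun_cat I D) (sig_map I C \<rho> h) F) G"
proof -
  let ?K = "Fun_cat I D"
  note K = is_category_Fun_cat[of I D]
  note XS = structuresD(2)[OF X] and YS = structuresD(2)[OF Y]
  define F' where "F' = (SOME F. F \<in> snd X)"
  have F': "F' \<in> snd X" unfolding F'_def using F by (rule someI)
  note m = subobject_member[OF K XS F] and m' = subobject_member[OF K XS F']
    and n = subobject_member[OF K YS G]
  note \<rho>h = sig_map_hom[OF signature_presignature h]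
  have Fh: "F \<in> hom ?K (Dom ?K F) (sig_at I \<rho> (fst X))" "F' \<in> hom ?K (Dom ?K F') (sig_at I \<rho> (fst X))"
    using m m' is_mono_Ar[OF m(1)] is_mono_Ar[OF m'(1)] unfolding hom_iff by auto
  have le: "mono_le ?K F F'" "mono_le ?K F' F"
    using F F' m(3) m'(3) by (auto simp: subobject_def)
  have "Arrow X h Y \<in> Ar (Struct I C D \<rho>) \<longleftrightarrow>
      subobject_le ?K (im ?K (Comp ?K (sig_map I C \<rho> h) F')) (snd Y)"
    using X Y h by (simp add: Struct_def direct_image_def F'_def)
  also have "\<dots> \<longleftrightarrow> mono_le ?K (Comp ?K (sig_map I C \<rho> h) F') G"
  proof (subst n(3), rule im_le_iff[OF K _ n(1)])
    show "has_image ?K (Comp ?K (sig_map I C \<rho> h) F')"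
      using sig h m'(1,2) unfolding signature_def hom_iff by metis
  qed
  also have "\<dots> \<longleftrightarrow> mono_le ?K (Comp ?K (sig_map I C \<rho> h) F) G"
    using mono_le_trans[OF K mono_le_Comp[OF K le(1) Fh(2) \<rho>h], of G]
      mono_le_trans[OF K mono_le_Comp[OF K le(2) Fh(1) \<rho>h], of G]
      Comp_hom[OF K Fh(1) \<rho>h] Comp_hom[OF K Fh(2) \<rho>h] is_mono_Ar[OF n(1)]
    unfolding hom_iff by blast
  finally show ?thesis .
qed

lemma structure_representative:
  assumes "X \<in> structures I C D \<rho>"
  obtains F where "F \<in> snd X" "F \<in> hom (Fun_cat I D) (Dom (Fun_cat I D) F) (sig_at I \<rho> (fst X))"
proof -
  note S = structuresD(2)[OF assms] and K = is_category_Fun_cat[of I D]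
  obtain F where F: "F \<in> snd X" using subobjects_nonempty[OF K S] by blast
  show thesis
    using that[OF F] subobject_member[OF K S F] is_mono_Ar[of "Fun_cat I D" F] unfolding hom_iff by blast
qed

text \<open>The identity induces the identity of \<open>\<rho>\<^sub>A\<close>, so \<open>F\<close>
  only has to factor through itself.\<close>

lemma Struct_Ident_hom:
  assumes X: "X \<in> structures I C D \<rho>"
  shows "Arrow X (Ident C (fst X)) X \<in> Ar (Struct I C D \<rho>)"
proof -
  note K = is_category_Fun_cat[of I D] and pre = signature_presignature
  obtain F where F: "F \<in> snd X" "F \<in> hom (Fun_cat I D) (Dom (Fun_cat I D) F) (sig_at I \<rho> (fst X))"
    using structure_representative[OF X] .
  have A: "fst X \<in> Ob C" using X by (rule structuresD)
  have FA: "F \<in> Ar (Fun_cat I D)" using F(2) unfolding hom_iff by blast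
  show ?thesis
    unfolding Struct_Ar_iff[OF X X F(1) F(1) Ident_hom[OF presig_cats(2)[OF pre] A]]
      sig_map_Ident[OF pre A] Comp_Ident_left[OF K F(2)]
    by (rule mono_le_refl[OF K FA])
qed

text \<open>With representatives \<open>F\<close>, \<open>G\<close>, \<open>H\<close> of the three
  structures, the image under \<open>\<rho>\<close> of the composite sends \<open>F\<close> to
  \<open>\<rho>\<^sub>g (\<rho>\<^sub>f F)\<close>, which factors through
  \<open>\<rho>\<^sub>g G\<close> and hence through \<open>H\<close>.\<close>

lemma Struct_Comp_Ar:
  assumes f: "f \<in> Ar (Struct I C D \<rho>)" and g: "g \<in> Ar (Struct I C D \<rho>)" and fg: "trg f = src g"
  shows "Arrow (src f) (Comp C (und g) (und f)) (trg g) \<in> Ar (Struct I C D \<rho>)"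
proof -
  let ?K = "Fun_cat I D"
  note K = is_category_Fun_cat[of I D] and pre = signature_presignature
  note f' = Struct_Ar_D[OF f, unfolded fg] and g' = Struct_Ar_D[OF g]
  obtain F where F: "F \<in> snd (src f)" "F \<in> hom ?K (Dom ?K F) (sig_at I \<rho> (fst (src f)))"
    using structure_representative[OF f'(1)] .
  obtain G where G: "G \<in> snd (src g)" "G \<in> hom ?K (Dom ?K G) (sig_at I \<rho> (fst (src g)))"
    using structure_representative[OF g'(1)] .
  obtain H where H: "H \<in> snd (trg g)" "H \<in> hom ?K (Dom ?K H) (sig_at I \<rho> (fst (trg g)))"
    using structure_representative[OF g'(2)] .
  note \<rho>f = sig_map_hom[OF pre f'(3)] and \<rho>g = sig_map_hom[OF pre g'(3)]
  have fa: "Arrow (src f) (und f) (src g) = f" "Arrow (src g) (und g) (trg g) = g"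
    by (metis arrow.collapse fg)+
  have "mono_le ?K (Comp ?K (sig_map I C \<rho> (und f)) F) G"
    using f fa(1) Struct_Ar_iff[OF f'(1,2) F(1) G(1) f'(3)] by simp
  from mono_le_Comp[OF K this G(2) \<rho>g]
  have 1: "mono_le ?K (Comp ?K (sig_map I C \<rho> (und g)) (Comp ?K (sig_map I C \<rho> (und f)) F))
      (Comp ?K (sig_map I C \<rho> (und g)) G)" .
  have 2: "mono_le ?K (Comp ?K (sig_map I C \<rho> (und g)) G) H"
    using g fa(2) Struct_Ar_iff[OF g'(1,2) G(1) H(1) g'(3)] by simp
  have ar: "Comp ?K (sig_map I C \<rho> (und g)) G \<in> Ar ?K" "H \<in> Ar ?K"
    using Comp_hom[OF K G(2) \<rho>g] H(2) unfolding hom_iff by blast+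
  show ?thesis
    unfolding Struct_Ar_iff[OF f'(1) g'(2) F(1) H(1) Comp_hom[OF presig_cats(2)[OF pre] f'(3) g'(3)]]
      sig_map_Comp[OF pre f'(3) g'(3)] Comp_assoc[OF K F(2) \<rho>f \<rho>g, symmetric]
    by (rule mono_le_trans[OF K 1 2 ar])
qed

lemma is_category_Struct: "is_category (Struct I C D \<rho>)"
proof (rule is_categoryI)
  note C = presig_cats(2)[OF signature_presignature]
  fix X Y Z W f g h
  assume "f \<in> hom (Struct I C D \<rho>) X Y"
  then have f: "f \<in> Ar (Struct I C D \<rho>)" "src f = X" "trg f = Y" by (auto simp: hom_iff)
  note fC = Struct_Ar_D(3)[OF f(1)]
  show "Comp (Struct I C D \<rho>) f (Ident (Struct I C D \<rho>) X) = f"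
    "Comp (Struct I C D \<rho>) (Ident (Struct I C D \<rho>) Y) f = f"
    using f Comp_Ident_right[OF C fC] Comp_Ident_left[OF C fC] by (auto simp: arrow.expand)
  assume "g \<in> hom (Struct I C D \<rho>) Y Z"
  then have g: "g \<in> Ar (Struct I C D \<rho>)" "src g = Y" "trg g = Z" by (auto simp: hom_iff)
  note gC = Struct_Ar_D(3)[OF g(1)]
  show "Comp (Struct I C D \<rho>) g f \<in> hom (Struct I C D \<rho>) X Z"
    using Struct_Comp_Ar[OF f(1) g(1)] f g by (simp add: hom_iff)
  assume "h \<in> hom (Struct I C D \<rho>) Z W"
  then have h: "h \<in> Ar (Struct I C D \<rho>)" "src h = Z" "trg h = W" by (auto simp: hom_iff)
  note hC = Struct_Ar_D(3)[OF h(1)]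
  show "Comp (Struct I C D \<rho>) h (Comp (Struct I C D \<rho>) g f) =
      Comp (Struct I C D \<rho>) (Comp (Struct I C D \<rho>) h g) f"
    using f g h Comp_assoc[OF C, of "und f" "fst X" "fst Y" "und g" "fst Z" "und h" "fst W"] fC gC hC
    by simp
qed (auto simp: hom_iff Struct_Ident_hom Struct_Ar_D)

end


section \<open>Functors into an exponential category\<close>

text \<open>Arrows of \<open>C\<close> are handled through their values: \<open>sapp\<close> reads
  an arrow as a HOL function and \<open>sfun\<close> builds one back, which keeps coded graphs out
  of most functor arguments.\<close>

definition sapp :: "'v::set_universe set_map \<Rightarrow> 'v \<Rightarrow> 'v" where
  "sapp f = vapp (und f)"

definition sfun :: "'v::set_universe \<Rightarrow> ('v \<Rightarrow> 'v) \<Rightarrow> 'v \<Rightarrow> 'v set_map" where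
  "sfun A m B = Arrow A (graph A m) B"

lemma sapp_sfun: "m \<in> elts A \<rightarrow> elts B \<Longrightarrow> x \<in> elts A \<Longrightarrow> sapp (sfun A m B) x = m x"
  by (simp add: sapp_def sfun_def vapp_graph)

text \<open>Common shape of the functors built below: kernel pairs, subfunctors and the exponential
  functors. Only the values of \<open>m \<nu>\<close> on its source set matter, since
  \<open>sfun\<close> keeps just the graph over that set.\<close>

definition set_functor ::
    "('jo, 'ja) category \<Rightarrow> ('jo \<Rightarrow> 'v::set_universe) \<Rightarrow> ('ja \<Rightarrow> 'v \<Rightarrow> 'v) \<Rightarrow>
     ('jo, 'ja, 'v, 'v set_map) cfunctor" where
  "set_functor J X m =
     \<lparr>FOb = (\<lambda>N\<in>Ob J. X N), FAr = (\<lambda>\<nu>\<in>Ar J. sfun (X (Dom J \<nu>)) (m \<nu>) (X (Cod J \<nu>)))\<rparr>"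

definition subfunctor ::
    "('jo, 'ja) category \<Rightarrow> ('jo, 'ja, 'v, 'v set_map) cfunctor \<Rightarrow> ('jo \<Rightarrow> 'v::set_universe) \<Rightarrow>
     ('jo, 'ja, 'v, 'v set_map) cfunctor" where
  "subfunctor J R V = set_functor J V (\<lambda>\<nu>. sapp (FAr R \<nu>))"

text \<open>The condition under which \<open>R\<close> restricts to a subfunctor with object map
  \<open>V\<close>.\<close>

definition stable_family ::
    "('jo, 'ja) category \<Rightarrow> ('jo, 'ja, 'v, 'v set_map) cfunctor \<Rightarrow> ('jo \<Rightarrow> 'v::set_universe) \<Rightarrow> bool" where
  "stable_family J R V \<longleftrightarrow>
     (\<forall>N\<in>Ob J. elts (V N) \<subseteq> elts (FOb R N)) \<and>
     (\<forall>\<nu>\<in>Ar J. \<forall>x\<in>elts (V (Dom J \<nu>)). sapp (FAr R \<nu>) x \<in> elts (V (Cod J \<nu>)))"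

definition inclusion ::
    "('jo, 'ja) category \<Rightarrow> ('jo, 'ja, 'v, 'v set_map) cfunctor \<Rightarrow> ('jo \<Rightarrow> 'v::set_universe) \<Rightarrow>
     ('jo, 'ja, 'v, 'v set_map) nt" where
  "inclusion J R V = Arrow (subfunctor J R V) (\<lambda>N\<in>Ob J. sfun (V N) (\<lambda>x. x) (FOb R N)) R"

lemma FOb_set_functor [simp]: "N \<in> Ob J \<Longrightarrow> FOb (set_functor J X m) N = X N"
  by (simp add: set_functor_def)

lemma FAr_set_functor: "\<nu> \<in> hom J N M \<Longrightarrow> FAr (set_functor J X m) \<nu> = sfun (X N) (m \<nu>) (X M)"
  by (auto simp: set_functor_def hom_iff)

lemma FOb_subfunctor [simp]: "N \<in> Ob J \<Longrightarrow> FOb (subfunctor J R V) N = V N"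
  by (simp add: subfunctor_def)

context
  fixes C :: "('v::set_universe, 'v set_map) category"
  assumes exp: "exponential_category C"
begin

lemma exp_simps:
  "Dom C = src" "Cod C = trg" "Ident C = (\<lambda>A. Arrow A (graph A (\<lambda>x. x)) A)"
  "Comp C = (\<lambda>g f. Arrow (src f) (vcomp (und g) (und f)) (trg g))"
proof -
  obtain X where "C = full_subcat Set_cat X" using exp unfolding exponential_category_def by blast
  then show "Dom C = src" "Cod C = trg" "Ident C = (\<lambda>A. Arrow A (graph A (\<lambda>x. x)) A)"
    "Comp C = (\<lambda>g f. Arrow (src f) (vcomp (und g) (und f)) (trg g))"
    by (simp_all add: full_subcat_def Set_cat_def)
qed

lemma exp_hom:
  "f \<in> hom C A B \<longleftrightarrow> A \<in> Ob C \<and> B \<in> Ob C \<and> src f = A \<and> trg f = B \<and> und f \<in> elts (vexp B A)"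
proof -
  obtain X where "C = full_subcat Set_cat X" using exp unfolding exponential_category_def by blast
  then show ?thesis by (auto simp: full_subcat_def Set_cat_def hom_iff)
qed

lemma exp_subset: "A \<in> Ob C \<Longrightarrow> elts B \<subseteq> elts A \<Longrightarrow> B \<in> Ob C"
  and exp_vexp: "A \<in> Ob C \<Longrightarrow> B \<in> Ob C \<Longrightarrow> vexp A B \<in> Ob C"
  using exp unfolding exponential_category_def by blast+

lemma exp_category: "is_category C"
proof (rule is_categoryI)
  show "Dom C f \<in> Ob C \<and> Cod C f \<in> Ob C" if "f \<in> Ar C" for f
    using that exp_hom[of f "Dom C f" "Cod C f"] by (simp add: hom_iff)
  fix A B E G f g h
  show "Ident C A \<in> hom C A A" if "A \<in> Ob C"
    using that by (simp add: exp_hom exp_simps graph_id_vexp)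
  assume f: "f \<in> hom C A B"
  then show "Comp C f (Ident C A) = f" "Comp C (Ident C B) f = f"
    by (auto simp: exp_hom exp_simps vcomp_id_left vcomp_id_right arrow.expand)
  assume g: "g \<in> hom C B E"
  then show "Comp C g f \<in> hom C A E"
    using f by (auto simp: exp_hom exp_simps intro: vcomp_vexp)
  assume "h \<in> hom C E G"
  then show "Comp C h (Comp C g f) = Comp C (Comp C h g) f"
    using f g by (auto simp: exp_hom exp_simps intro: vcomp_assoc)
qed

lemma exp_hom_eqI:
  assumes "f \<in> hom C A B" "g \<in> hom C A B" "\<And>x. x \<in> elts A \<Longrightarrow> sapp f x = sapp g x"
  shows "f = g"
proof -
  have "und f = und g"
    using assms(1,2) assms(3)[unfolded sapp_def]
    by (intro vexp_eqI[of "und f" B A "und g" B]) (simp_all add: exp_hom)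
  then show ?thesis using assms(1,2) by (intro arrow.expand) (simp_all add: exp_hom)
qed

lemma sapp_in: "f \<in> hom C A B \<Longrightarrow> x \<in> elts A \<Longrightarrow> sapp f x \<in> elts B"
  by (auto simp: exp_hom sapp_def vapp_in)

lemma sapp_Comp:
  "f \<in> hom C A B \<Longrightarrow> g \<in> hom C B E \<Longrightarrow> x \<in> elts A \<Longrightarrow> sapp (Comp C g f) x = sapp g (sapp f x)"
  by (auto simp: exp_hom sapp_def exp_simps vapp_vcomp)

lemma sapp_Ident: "x \<in> elts A \<Longrightarrow> sapp (Ident C A) x = x"
  by (simp add: sapp_def exp_simps vapp_id)

lemma sfun_hom:
  "A \<in> Ob C \<Longrightarrow> B \<in> Ob C \<Longrightarrow> m \<in> elts A \<rightarrow> elts B \<Longrightarrow> sfun A m B \<in> hom C A B"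
  by (simp add: exp_hom sfun_def graph_vexp)

lemma is_functor_set_functor:
  assumes J: "is_category J"
    and X: "\<And>N. N \<in> Ob J \<Longrightarrow> X N \<in> Ob C"
    and m: "\<And>N M \<nu>. \<nu> \<in> hom J N M \<Longrightarrow> m \<nu> \<in> elts (X N) \<rightarrow> elts (X M)"
    and id: "\<And>N x. N \<in> Ob J \<Longrightarrow> x \<in> elts (X N) \<Longrightarrow> m (Ident J N) x = x"
    and comp: "\<And>N M L \<nu> \<mu> x. \<nu> \<in> hom J N M \<Longrightarrow> \<mu> \<in> hom J M L \<Longrightarrow> x \<in> elts (X N) \<Longrightarrow>
      m (Comp J \<mu> \<nu>) x = m \<mu> (m \<nu> x)"
  shows "is_functor J C (set_functor J X m)"
proof (rule is_functorI[OF J exp_category])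
  have h: "FAr (set_functor J X m) \<nu> \<in> hom C (X N) (X M)" if "\<nu> \<in> hom J N M" for \<nu> N M
    unfolding FAr_set_functor[OF that] using hom_Ob[OF J that] by (intro sfun_hom X m[OF that]) auto
  have a: "sapp (FAr (set_functor J X m) \<nu>) x = m \<nu> x" if "\<nu> \<in> hom J N M" "x \<in> elts (X N)" for \<nu> N M x
    unfolding FAr_set_functor[OF that(1)] using that m by (intro sapp_sfun)
  show "FAr (set_functor J X m) \<nu> \<in> hom C (FOb (set_functor J X m) N) (FOb (set_functor J X m) M)"
    if "\<nu> \<in> hom J N M" for \<nu> N M
    using h[OF that] hom_Ob[OF J that] by simp
  show "FAr (set_functor J X m) (Ident J N) = Ident C (FOb (set_functor J X m) N)" if N: "N \<in> Ob J" for N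
  proof (rule exp_hom_eqI[OF h[OF Ident_hom[OF J N]]])
    show "Ident C (FOb (set_functor J X m) N) \<in> hom C (X N) (X N)"
      using N Ident_hom[OF exp_category X[OF N]] by simp
    fix x assume "x \<in> elts (X N)"
    then show "sapp (FAr (set_functor J X m) (Ident J N)) x = sapp (Ident C (FOb (set_functor J X m) N)) x"
      using N id by (simp add: a[OF Ident_hom[OF J N]] sapp_Ident)
  qed
  show "FAr (set_functor J X m) (Comp J \<mu> \<nu>) = Comp C (FAr (set_functor J X m) \<mu>) (FAr (set_functor J X m) \<nu>)"
    if \<nu>: "\<nu> \<in> hom J N M" and \<mu>: "\<mu> \<in> hom J M L" for \<nu> \<mu> N M L
  proof (rule exp_hom_eqI[OF h[OF Comp_hom[OF J \<nu> \<mu>]] Comp_hom[OF exp_category h[OF \<nu>] h[OF \<mu>]]])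
    fix x assume x: "x \<in> elts (X N)"
    then have "m \<nu> x \<in> elts (X M)" using m[OF \<nu>] by blast
    then show "sapp (FAr (set_functor J X m) (Comp J \<mu> \<nu>)) x =
        sapp (Comp C (FAr (set_functor J X m) \<mu>) (FAr (set_functor J X m) \<nu>)) x"
      using x by (simp add: sapp_Comp[OF h[OF \<nu>] h[OF \<mu>]] a[OF Comp_hom[OF J \<nu> \<mu>]] a[OF \<nu>] a[OF \<mu>] comp[OF \<nu> \<mu>])
  qed
qed (use X in \<open>auto simp: set_functor_def\<close>)

lemma is_nat_trans_sfun:
  assumes U: "is_functor J C U" and R: "is_functor J C R"
    and \<tau>: "\<And>N. N \<in> Ob J \<Longrightarrow> \<tau> N \<in> elts (FOb U N) \<rightarrow> elts (FOb R N)"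
    and nat: "\<And>N M \<nu> x. \<nu> \<in> hom J N M \<Longrightarrow> x \<in> elts (FOb U N) \<Longrightarrow>
      \<tau> M (sapp (FAr U \<nu>) x) = sapp (FAr R \<nu>) (\<tau> N x)"
  shows "is_nat_trans J C U R (\<lambda>N\<in>Ob J. sfun (FOb U N) (\<tau> N) (FOb R N))"
proof (rule is_nat_transI[OF U R])
  note J = is_functor_cats(1)[OF U]
  have h: "sfun (FOb U N) (\<tau> N) (FOb R N) \<in> hom C (FOb U N) (FOb R N)" if "N \<in> Ob J" for N
    using that by (intro sfun_hom is_functor_FOb[OF U] is_functor_FOb[OF R] \<tau>)
  then show "(\<lambda>N\<in>Ob J. sfun (FOb U N) (\<tau> N) (FOb R N)) N \<in> hom C (FOb U N) (FOb R N)"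
    if "N \<in> Ob J" for N using that by simp
  show "Comp C ((\<lambda>N\<in>Ob J. sfun (FOb U N) (\<tau> N) (FOb R N)) M) (FAr U \<nu>) =
      Comp C (FAr R \<nu>) ((\<lambda>N\<in>Ob J. sfun (FOb U N) (\<tau> N) (FOb R N)) N)"
    if \<nu>: "\<nu> \<in> hom J N M" for \<nu> N M
  proof -
    have N: "N \<in> Ob J" and M: "M \<in> Ob J" using hom_Ob[OF J \<nu>] by auto
    note U\<nu> = is_functor_FAr[OF U \<nu>] and R\<nu> = is_functor_FAr[OF R \<nu>]
    have "Comp C (sfun (FOb U M) (\<tau> M) (FOb R M)) (FAr U \<nu>) =
        Comp C (FAr R \<nu>) (sfun (FOb U N) (\<tau> N) (FOb R N))"
    proof (rule exp_hom_eqI[OF Comp_hom[OF exp_category U\<nu> h[OF M]] Comp_hom[OF exp_category h[OF N] R\<nu>]])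
      fix x assume x: "x \<in> elts (FOb U N)"
      show "sapp (Comp C (sfun (FOb U M) (\<tau> M) (FOb R M)) (FAr U \<nu>)) x =
        sapp (Comp C (FAr R \<nu>) (sfun (FOb U N) (\<tau> N) (FOb R N))) x"
        using sapp_in[OF U\<nu> x]
        by (simp add: x sapp_Comp[OF U\<nu> h[OF M]] sapp_Comp[OF h[OF N] R\<nu>] sapp_sfun[OF \<tau>[OF N]]
            sapp_sfun[OF \<tau>[OF M]] nat[OF \<nu>])
    qed
    then show ?thesis using N M by simp
  qed
qed simp

lemma sapp_natural:
  assumes t: "is_nat_trans J C U R \<tau>" and \<nu>: "\<nu> \<in> hom J N M" and x: "x \<in> elts (FOb U N)"
  shows "sapp (\<tau> M) (sapp (FAr U \<nu>) x) = sapp (FAr R \<nu>) (sapp (\<tau> N) x)"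
proof -
  note fs = is_nat_trans_functors[OF t]
  have N: "N \<in> Ob J" and M: "M \<in> Ob J" using hom_Ob[OF is_functor_cats(1)[OF fs(1)] \<nu>] by auto
  show ?thesis
    using arg_cong[OF is_nat_trans_nat[OF t \<nu>], of "\<lambda>f. sapp f x"]
    by (simp add: x sapp_Comp[OF is_functor_FAr[OF fs(1) \<nu>] is_nat_trans_hom[OF t M]]
        sapp_Comp[OF is_nat_trans_hom[OF t N] is_functor_FAr[OF fs(2) \<nu>]])
qed

lemma nat_trans_eqI:
  assumes s: "s \<in> hom (Fun_cat J C) U R" and t: "t \<in> hom (Fun_cat J C) U R"
    and eq: "\<And>N x. N \<in> Ob J \<Longrightarrow> x \<in> elts (FOb U N) \<Longrightarrow> sapp (und s N) x = sapp (und t N) x"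
  shows "s = t"
proof -
  have sn: "is_nat_trans J C U R (und s)" and tn: "is_nat_trans J C U R (und t)"
    using s t by (auto simp: hom_Fun_cat)
  have "und s = und t"
    using is_nat_trans_extensional[OF sn] is_nat_trans_extensional[OF tn]
    by (rule extensionalityI) (intro exp_hom_eqI[OF is_nat_trans_hom[OF sn] is_nat_trans_hom[OF tn]] eq)
  then show ?thesis using s t by (intro arrow.expand) (simp_all add: hom_Fun_cat)
qed

lemma sapp_Comp_Fun:
  assumes s: "s \<in> hom (Fun_cat J C) U R" and t: "t \<in> hom (Fun_cat J C) R S"
    and N: "N \<in> Ob J" and x: "x \<in> elts (FOb U N)"
  shows "sapp (und (Comp (Fun_cat J C) t s) N) x = sapp (und t N) (sapp (und s N) x)"
  using assms by (auto simp: hom_Fun_cat intro: sapp_Comp is_nat_trans_hom)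

lemma sapp_und_in:
  "t \<in> hom (Fun_cat J C) U R \<Longrightarrow> N \<in> Ob J \<Longrightarrow> x \<in> elts (FOb U N) \<Longrightarrow> sapp (und t N) x \<in> elts (FOb R N)"
  by (auto simp: hom_Fun_cat intro: sapp_in is_nat_trans_hom)

section \<open>Monomorphisms of functors, pointwise\<close>

lemma is_mono_pointwise:
  assumes t: "t \<in> hom (Fun_cat J C) U R"
    and inj: "\<And>N. N \<in> Ob J \<Longrightarrow> inj_on (sapp (und t N)) (elts (FOb U N))"
  shows "is_mono (Fun_cat J C) t"
  unfolding is_mono_def
proof (intro conjI ballI impI)
  show "t \<in> Ar (Fun_cat J C)" using t unfolding hom_iff by blast
  fix f g assume "f \<in> Ar (Fun_cat J C)" "g \<in> Ar (Fun_cat J C)"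
    and fg: "Dom (Fun_cat J C) f = Dom (Fun_cat J C) g \<and> Cod (Fun_cat J C) f = Dom (Fun_cat J C) t \<and>
      Cod (Fun_cat J C) g = Dom (Fun_cat J C) t \<and> Comp (Fun_cat J C) t f = Comp (Fun_cat J C) t g"
  then have f: "f \<in> hom (Fun_cat J C) (src f) U" and g: "g \<in> hom (Fun_cat J C) (src f) U"
    using t by (simp_all add: hom_iff)
  show "f = g"
  proof (rule nat_trans_eqI[OF f g])
    fix N x assume N: "N \<in> Ob J" and x: "x \<in> elts (FOb (src f) N)"
    have "sapp (und t N) (sapp (und f N) x) = sapp (und t N) (sapp (und g N) x)"
      using fg sapp_Comp_Fun[OF f t N x] sapp_Comp_Fun[OF g t N x] by metis
    then show "sapp (und f N) x = sapp (und g N) x"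
      using inj_onD[OF inj[OF N]] sapp_und_in[OF f N x] sapp_und_in[OF g N x] by blast
  qed
qed

text \<open>Two points \<open>x \<noteq> y\<close> of some \<open>U N\<close> identified by \<open>t\<close> form a two-element object \<open>T\<close> of \<open>C\<close>.
  The kernel pair of \<open>t\<close> then exists as a subfunctor of \<open>M \<mapsto> (U M)\<^sup>T\<close>, whose two projections
  are the evaluations at \<open>x\<close> and \<open>y\<close>.\<close>

lemma mono_pointwise_inj:
  assumes mono: "is_mono (Fun_cat J C) t" and t: "t \<in> hom (Fun_cat J C) U R" and N: "N \<in> Ob J"
  shows "inj_on (sapp (und t N)) (elts (FOb U N))"
proof (rule inj_onI)
  fix x y assume x: "x \<in> elts (FOb U N)" and y: "y \<in> elts (FOb U N)"
    and xy: "sapp (und t N) x = sapp (und t N) y"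
  have tn: "is_nat_trans J C U R (und t)" using t by (simp add: hom_Fun_cat)
  note U = is_nat_trans_functors(1)[OF tn] and R = is_nat_trans_functors(2)[OF tn]
  note J = is_functor_cats(1)[OF U]
  define T where "T = vset {x, y}"
  have T: "elts T = {x, y}" unfolding T_def by (rule elts_vset_pair)
  have "T \<in> Ob C" using exp_subset[OF is_functor_FOb[OF U N]] x y T by simp
  \<comment> \<open>A function \<open>g\<close> on \<open>T\<close> codes the pair of its values at
    \<open>x\<close> and \<open>y\<close>, so \<open>P M\<close> is the set of pairs of points of
    \<open>U M\<close> that \<open>t\<close> identifies. It is a subset of an exponential, hence an
    object of \<open>C\<close>.\<close>
  define P where "P M = vset {g \<in> elts (vexp (FOb U M) T).
    sapp (und t M) (vapp g x) = sapp (und t M) (vapp g y)}" for M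
  define m where "m \<nu> g = vcomp (und (FAr U \<nu>)) g" for \<nu> g
  have P: "elts (P M) = {g \<in> elts (vexp (FOb U M) T).
    sapp (und t M) (vapp g x) = sapp (und t M) (vapp g y)}" for M
    unfolding P_def by (rule elts_vset[of _ "vexp (FOb U M) T"]) blast
  have POb: "P M \<in> Ob C" if "M \<in> Ob J" for M
    by (rule exp_subset[OF exp_vexp[OF is_functor_FOb[OF U that] \<open>T \<in> Ob C\<close>]]) (auto simp: P)
  have U\<nu>: "und (FAr U \<nu>) \<in> elts (vexp (FOb U M) (FOb U L))" if "\<nu> \<in> hom J L M" for \<nu> L M
    using is_functor_FAr[OF U that] by (simp add: exp_hom)
  have app: "vapp (m \<nu> g) z = sapp (FAr U \<nu>) (vapp g z)"
    if "\<nu> \<in> hom J L M" "g \<in> elts (P L)" "z \<in> {x, y}" for \<nu> L M g z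
    using that U\<nu>[OF that(1)] by (auto simp: m_def sapp_def P T vapp_vcomp[of _ "FOb U L" T])
  have gz: "vapp g z \<in> elts (FOb U M)" if "g \<in> elts (P M)" "z \<in> {x, y}" for g z M
    using that by (auto simp: P T intro: vapp_in)
  \<comment> \<open>Identified pairs go to identified pairs because \<open>t\<close> is
    natural.\<close>
  have mP: "m \<nu> \<in> elts (P L) \<rightarrow> elts (P M)" if \<nu>: "\<nu> \<in> hom J L M" for \<nu> L M
  proof
    fix g assume g: "g \<in> elts (P L)"
    have "m \<nu> g \<in> elts (vexp (FOb U M) T)"
      using g U\<nu>[OF \<nu>] by (auto simp: P m_def intro: vcomp_vexp)
    moreover have "sapp (und t M) (vapp (m \<nu> g) x) = sapp (und t M) (vapp (m \<nu> g) y)"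
      using g by (simp add: app[OF \<nu>] sapp_natural[OF tn \<nu>] gz) (simp add: P)
    ultimately show "m \<nu> g \<in> elts (P M)" by (simp add: P)
  qed
  let ?P = "set_functor J P m"
  have PF: "is_functor J C ?P"
  proof (rule is_functor_set_functor[OF J POb mP])
    show "m (Ident J M) g = g" if "M \<in> Ob J" "g \<in> elts (P M)" for M g
      using that by (auto simp: m_def P is_functor_Ident[OF U] exp_simps intro: vcomp_id_left)
    show "m (Comp J \<mu> \<nu>) g = m \<mu> (m \<nu> g)"
      if "\<nu> \<in> hom J L M" "\<mu> \<in> hom J M K" "g \<in> elts (P L)" for L M K \<nu> \<mu> g
      using that U\<nu>[OF that(1)] U\<nu>[OF that(2)]
      by (auto simp: m_def P is_functor_Comp[OF U that(1,2)] exp_simps intro: vcomp_assoc[symmetric])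
  qed
  define e where "e z = Arrow ?P (\<lambda>M\<in>Ob J. sfun (FOb ?P M) (\<lambda>g. vapp g z) (FOb U M)) U" for z
  have e: "e z \<in> hom (Fun_cat J C) ?P U" if z: "z \<in> {x, y}" for z
  proof -
    have "is_nat_trans J C ?P U (\<lambda>M\<in>Ob J. sfun (FOb ?P M) (\<lambda>g. vapp g z) (FOb U M))"
    proof (rule is_nat_trans_sfun[OF PF U])
      show "(\<lambda>g. vapp g z) \<in> elts (FOb ?P M) \<rightarrow> elts (FOb U M)" if "M \<in> Ob J" for M
        using that z gz by auto
      show "vapp (sapp (FAr ?P \<nu>) g) z = sapp (FAr U \<nu>) (vapp g z)"
        if \<nu>: "\<nu> \<in> hom J L M" and g: "g \<in> elts (FOb ?P L)" for \<nu> L M g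
      proof -
        have "g \<in> elts (P L)" using g hom_Ob[OF J \<nu>] by simp
        then show ?thesis using z by (simp add: FAr_set_functor[OF \<nu>] sapp_sfun[OF mP[OF \<nu>]] app[OF \<nu>])
      qed
    qed
    then show ?thesis by (simp add: hom_Fun_cat e_def)
  qed
  have ev: "sapp (und (e z) M) g = vapp g z" if "M \<in> Ob J" "g \<in> elts (P M)" "z \<in> {x, y}" for z M g
    using that gz by (simp add: e_def) (intro sapp_sfun, auto)
  have "e x = e y"
  proof -
    have ex: "e x \<in> hom (Fun_cat J C) ?P U" and ey: "e y \<in> hom (Fun_cat J C) ?P U"
      using e by blast+
    have "Comp (Fun_cat J C) t (e x) = Comp (Fun_cat J C) t (e y)"
    proof (rule nat_trans_eqI)
      fix M g assume M: "M \<in> Ob J" and g: "g \<in> elts (FOb ?P M)"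
      show "sapp (und (Comp (Fun_cat J C) t (e x)) M) g = sapp (und (Comp (Fun_cat J C) t (e y)) M) g"
        unfolding sapp_Comp_Fun[OF ex t M g] sapp_Comp_Fun[OF ey t M g]
        using M g by (simp add: ev) (simp add: P)
    qed (rule Comp_hom[OF is_category_Fun_cat ex t] Comp_hom[OF is_category_Fun_cat ey t])+
    then show ?thesis by (rule is_monoD[OF mono t ex ey])
  qed
  \<comment> \<open>The pair (x, y) is coded by the inclusion of \<open>T\<close> into
    \<open>U N\<close>. It belongs to \<open>P N\<close> by the assumption on \<open>x\<close> and
    \<open>y\<close>, and the two equal projections send it to \<open>x\<close> and to
    \<open>y\<close>.\<close>
  moreover have "(\<lambda>z. z) \<in> elts T \<rightarrow> elts (FOb U N)" using x y T by auto
  note g = graph_vexp[OF this] vapp_graph[OF this]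
  have "graph T (\<lambda>z. z) \<in> elts (P N)" using g xy by (simp add: P T)
  ultimately show "x = y" using ev[OF N, of "graph T (\<lambda>z. z)"] g(2) T by (metis insertCI)
qed

text \<open>If the values of \<open>t\<close> lie among those of \<open>n\<close>, a factoring
  function exists at each object. Injectivity of the components of \<open>n\<close> makes it unique
  there, and this forces the family to be natural.\<close>

lemma mono_le_pointwise_iff:
  assumes n: "is_mono (Fun_cat J C) n" "n \<in> hom (Fun_cat J C) V R" and t: "t \<in> hom (Fun_cat J C) U R"
  shows "mono_le (Fun_cat J C) t n \<longleftrightarrow>
    (\<forall>N\<in>Ob J. \<forall>x\<in>elts (FOb U N). sapp (und t N) x \<in> sapp (und n N) ` elts (FOb V N))"
    (is "?L \<longleftrightarrow> ?R")
proof
  have nt: "Dom (Fun_cat J C) n = V" "Dom (Fun_cat J C) t = U"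
    "Cod (Fun_cat J C) n = R" "Cod (Fun_cat J C) t = R"
    using n t unfolding hom_iff by auto
  {
    assume ?L
    then obtain s where s: "s \<in> hom (Fun_cat J C) U V" "Comp (Fun_cat J C) n s = t"
      unfolding mono_le_def nt by blast
    show ?R
      using sapp_Comp_Fun[OF s(1) n(2)] sapp_und_in[OF s(1)] unfolding s(2) by blast
  next
    assume R: ?R
    have tn: "is_nat_trans J C U R (und t)" and nn: "is_nat_trans J C V R (und n)"
      using n t by (auto simp: hom_Fun_cat)
    note U = is_nat_trans_functors(1)[OF tn] and V = is_nat_trans_functors(1)[OF nn]
    note J = is_functor_cats(1)[OF U]
    define \<sigma> where "\<sigma> N x = inv_into (elts (FOb V N)) (sapp (und n N)) (sapp (und t N) x)" for N x
    have \<sigma>: "\<sigma> N x \<in> elts (FOb V N)" "sapp (und n N) (\<sigma> N x) = sapp (und t N) x"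
      if "N \<in> Ob J" "x \<in> elts (FOb U N)" for N x
      using R that unfolding \<sigma>_def by (blast intro: inv_into_into f_inv_into_f)+
    define s where "s = Arrow U (\<lambda>N\<in>Ob J. sfun (FOb U N) (\<sigma> N) (FOb V N)) V"
    have "is_nat_trans J C U V (\<lambda>N\<in>Ob J. sfun (FOb U N) (\<sigma> N) (FOb V N))"
    proof (rule is_nat_trans_sfun[OF U V])
      show "\<sigma> M (sapp (FAr U \<nu>) x) = sapp (FAr V \<nu>) (\<sigma> N x)"
        if \<nu>: "\<nu> \<in> hom J N M" and x: "x \<in> elts (FOb U N)" for N M \<nu> x
      proof -
        have N: "N \<in> Ob J" and M: "M \<in> Ob J" using hom_Ob[OF J \<nu>] by auto
        note Ux = sapp_in[OF is_functor_FAr[OF U \<nu>] x]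
        \<comment> \<open>Naturality of \<open>\<sigma>\<close> is checked after applying the
          injective component of \<open>n\<close> at \<open>M\<close>, where it turns into
          naturality of \<open>t\<close> and of \<open>n\<close>.\<close>
        have "sapp (und n M) (\<sigma> M (sapp (FAr U \<nu>) x)) = sapp (und n M) (sapp (FAr V \<nu>) (\<sigma> N x))"
          by (simp add: \<sigma> N M Ux x sapp_natural[OF tn \<nu>] sapp_natural[OF nn \<nu>])
        then show ?thesis
          using inj_onD[OF mono_pointwise_inj[OF n M]] \<sigma>(1)[OF M Ux] \<sigma>(1)[OF N x]
            sapp_in[OF is_functor_FAr[OF V \<nu>]] by blast
      qed
    qed (use \<sigma> in blast)
    then have s: "s \<in> hom (Fun_cat J C) U V" by (simp add: hom_Fun_cat s_def)
    have "Comp (Fun_cat J C) n s = t"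
    proof (rule nat_trans_eqI[OF Comp_hom[OF is_category_Fun_cat s n(2)] t])
      fix N x assume N: "N \<in> Ob J" and x: "x \<in> elts (FOb U N)"
      have "sapp (und s N) x = \<sigma> N x"
        unfolding s_def using N x \<sigma>(1)[OF N] by (simp, intro sapp_sfun) auto
      then show "sapp (und (Comp (Fun_cat J C) n s) N) x = sapp (und t N) x"
        unfolding sapp_Comp_Fun[OF s n(2) N x] using \<sigma>(2)[OF N x] by simp
    qed
    then show ?L unfolding mono_le_def nt using s by blast
  }
qed

section \<open>Inclusions of subfunctors and images\<close>

text \<open>Closure of \<open>C\<close> under subsets makes \<open>V\<close> an object map into
  \<open>C\<close>. An inclusion does not move points, so the factorization criterion becomes plain
  membership in \<open>V N\<close>.\<close>

lemma
  assumes R: "is_functor J C R"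
    and stable: "stable_family J R V"
  shows inclusion_hom: "inclusion J R V \<in> hom (Fun_cat J C) (subfunctor J R V) R"
    and is_mono_inclusion: "is_mono (Fun_cat J C) (inclusion J R V)"
    and mono_le_inclusion_iff: "t \<in> hom (Fun_cat J C) U R \<Longrightarrow>
      mono_le (Fun_cat J C) t (inclusion J R V) \<longleftrightarrow>
      (\<forall>N\<in>Ob J. \<forall>x\<in>elts (FOb U N). sapp (und t N) x \<in> elts (V N))"
    and sapp_inclusion: "N \<in> Ob J \<Longrightarrow> x \<in> elts (V N) \<Longrightarrow> sapp (und (inclusion J R V) N) x = x"
proof -
  have sub: "elts (V N) \<subseteq> elts (FOb R N)" if "N \<in> Ob J" for N
    using that stable unfolding stable_family_def by blast
  have closed: "sapp (FAr R \<nu>) x \<in> elts (V M)" if "\<nu> \<in> hom J N M" "x \<in> elts (V N)" for N M \<nu> x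
    using that stable unfolding stable_family_def hom_iff by blast
  note J = is_functor_cats(1)[OF R]
  have VF: "is_functor J C (subfunctor J R V)"
    unfolding subfunctor_def
  proof (rule is_functor_set_functor[OF J])
    show "V N \<in> Ob C" if "N \<in> Ob J" for N
      using exp_subset[OF is_functor_FOb[OF R that] sub[OF that]] .
    show "sapp (FAr R (Ident J N)) x = x" if "N \<in> Ob J" "x \<in> elts (V N)" for N x
      using that sub[OF that(1)] by (auto simp: is_functor_Ident[OF R] sapp_Ident)
    show "sapp (FAr R (Comp J \<mu> \<nu>)) x = sapp (FAr R \<mu>) (sapp (FAr R \<nu>) x)"
      if "\<nu> \<in> hom J N M" "\<mu> \<in> hom J M L" "x \<in> elts (V N)" for N M L \<nu> \<mu> x
    proof -
      have "x \<in> elts (FOb R N)" using that sub hom_Ob[OF J that(1)] by blast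
      then show ?thesis
        unfolding is_functor_Comp[OF R that(1,2)]
        by (rule sapp_Comp[OF is_functor_FAr[OF R that(1)] is_functor_FAr[OF R that(2)]])
    qed
  qed (use closed in blast)
  have "is_nat_trans J C (subfunctor J R V) R
    (\<lambda>N\<in>Ob J. sfun (FOb (subfunctor J R V) N) (\<lambda>x. x) (FOb R N))"
  proof (rule is_nat_trans_sfun[OF VF R])
    show "sapp (FAr (subfunctor J R V) \<nu>) x = sapp (FAr R \<nu>) x"
      if \<nu>: "\<nu> \<in> hom J N M" and x: "x \<in> elts (FOb (subfunctor J R V) N)" for N M \<nu> x
      unfolding subfunctor_def FAr_set_functor[OF \<nu>]
      using x hom_Ob[OF J \<nu>] closed[OF \<nu>] by (intro sapp_sfun) auto
  qed (use sub in auto)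
  then have "is_nat_trans J C (subfunctor J R V) R (\<lambda>N\<in>Ob J. sfun (V N) (\<lambda>x. x) (FOb R N))"
    by (simp cong: restrict_cong)
  then show 1: "inclusion J R V \<in> hom (Fun_cat J C) (subfunctor J R V) R"
    by (simp add: hom_Fun_cat inclusion_def)
  show 2: "sapp (und (inclusion J R V) N) x = x" if "N \<in> Ob J" "x \<in> elts (V N)" for N x
    using that sub[OF that(1)] by (simp add: inclusion_def) (intro sapp_sfun, auto)
  show 3: "is_mono (Fun_cat J C) (inclusion J R V)"
    by (rule is_mono_pointwise[OF 1]) (simp add: inj_on_def 2)
  show "mono_le (Fun_cat J C) t (inclusion J R V) \<longleftrightarrow>
      (\<forall>N\<in>Ob J. \<forall>x\<in>elts (FOb U N). sapp (und t N) x \<in> elts (V N))"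
    if "t \<in> hom (Fun_cat J C) U R"
    unfolding mono_le_pointwise_iff[OF 3 1 that] by (simp add: 2 cong: image_cong)
qed

text \<open>The image at \<open>N\<close> is the set of values of \<open>t\<close> at
  \<open>N\<close>. Naturality makes these sets stable under \<open>R\<close>, so they form a
  subfunctor, and its inclusion is the least monomorphism through which \<open>t\<close>
  factors.\<close>

lemma has_image_Fun_cat:
  assumes t: "t \<in> hom (Fun_cat J C) U R"
  shows "has_image (Fun_cat J C) t"
proof -
  have tn: "is_nat_trans J C U R (und t)" using t by (simp add: hom_Fun_cat)
  note U = is_nat_trans_functors(1)[OF tn] and R = is_nat_trans_functors(2)[OF tn]
  note J = is_functor_cats(1)[OF U]
  define V where "V N = vset (sapp (und t N) ` elts (FOb U N))" for N
  have V: "elts (V N) = sapp (und t N) ` elts (FOb U N)" if "N \<in> Ob J" for N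
    unfolding V_def using sapp_und_in[OF t that] by (intro elts_vset[of _ "FOb R N"]) blast
  define \<psi> where "\<psi> = inclusion J R V"
  have sub: "elts (V N) \<subseteq> elts (FOb R N)" if "N \<in> Ob J" for N
    unfolding V[OF that] using sapp_und_in[OF t that] by blast
  have closed: "sapp (FAr R \<nu>) y \<in> elts (V M)" if \<nu>: "\<nu> \<in> hom J N M" and y: "y \<in> elts (V N)" for N M \<nu> y
  proof -
    have N: "N \<in> Ob J" and M: "M \<in> Ob J" using hom_Ob[OF J \<nu>] by auto
    obtain x where x: "x \<in> elts (FOb U N)" "y = sapp (und t N) x" using y V[OF N] by auto
    show ?thesis
      unfolding x(2) V[OF M] sapp_natural[OF tn \<nu> x(1), symmetric]
      using sapp_in[OF is_functor_FAr[OF U \<nu>] x(1)] by blast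
  qed
  have stable: "stable_family J R V"
    using sub closed unfolding stable_family_def hom_iff by blast
  note incl = inclusion_hom[OF R stable, folded \<psi>_def] is_mono_inclusion[OF R stable, folded \<psi>_def]
    mono_le_inclusion_iff[OF R stable t, folded \<psi>_def] sapp_inclusion[OF R stable, folded \<psi>_def]
  have dc: "Dom (Fun_cat J C) t = U" "Cod (Fun_cat J C) t = R"
    "Dom (Fun_cat J C) \<psi> = subfunctor J R V" "Cod (Fun_cat J C) \<psi> = R"
    using t incl(1) unfolding hom_iff by auto
  have "mono_le (Fun_cat J C) t \<psi>" unfolding incl(3) by (simp add: V)
  then obtain \<theta> where \<theta>: "\<theta> \<in> hom (Fun_cat J C) U (subfunctor J R V)" "Comp (Fun_cat J C) \<psi> \<theta> = t"
    unfolding mono_le_def dc by blast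
  have "image_triple (Fun_cat J C) t (subfunctor J R V) \<theta> \<psi>"
    unfolding image_triple_def
  proof (intro conjI allI impI)
    show "image_candidate (Fun_cat J C) t (subfunctor J R V) \<theta> \<psi>"
      unfolding image_candidate_def dc
      using \<theta>(1) \<theta>(2)[symmetric] incl(1,2) hom_Ob[OF is_category_Fun_cat incl(1)] by blast
    fix V2 \<theta>2 \<psi>2 assume "image_candidate (Fun_cat J C) t V2 \<theta>2 \<psi>2"
    then have *: "\<theta>2 \<in> hom (Fun_cat J C) U V2" "\<psi>2 \<in> hom (Fun_cat J C) V2 R"
      "is_mono (Fun_cat J C) \<psi>2" "t = Comp (Fun_cat J C) \<psi>2 \<theta>2"
      by (simp_all only: image_candidate_def dc)
    have dc2: "Dom (Fun_cat J C) \<psi>2 = V2"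
      using *(2) by (simp add: hom_Fun_cat)
    have "mono_le (Fun_cat J C) t \<psi>2"
      unfolding *(4) by (rule mono_leI[OF is_category_Fun_cat *(2,1)])
    then have "\<forall>N\<in>Ob J. \<forall>x\<in>elts (FOb U N). sapp (und t N) x \<in> sapp (und \<psi>2 N) ` elts (FOb V2 N)"
      unfolding mono_le_pointwise_iff[OF *(3,2) t] .
    \<comment> \<open>The inclusion \<open>\<psi>\<close> and \<open>t\<close> have the same values
      at every object, so the pointwise criterion cannot tell them apart.\<close>
    then have "mono_le (Fun_cat J C) \<psi> \<psi>2"
      unfolding mono_le_pointwise_iff[OF *(3,2) incl(1)] by (auto simp: incl(4) V)
    then obtain s where s: "s \<in> hom (Fun_cat J C) (subfunctor J R V) V2" "Comp (Fun_cat J C) \<psi>2 s = \<psi>"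
      unfolding mono_le_def dc dc2 by blast
    show "\<exists>!s. s \<in> hom (Fun_cat J C) (subfunctor J R V) V2 \<and> Comp (Fun_cat J C) \<psi>2 s = \<psi>"
    proof (rule ex1I)
      fix s' assume "s' \<in> hom (Fun_cat J C) (subfunctor J R V) V2 \<and> Comp (Fun_cat J C) \<psi>2 s' = \<psi>"
      then show "s' = s" using is_monoD[OF *(3,2) _ s(1)] unfolding s(2) by blast
    qed (use s in blast)
  qed
  then show ?thesis unfolding has_image_def by blast
qed

end


section \<open>The Yoneda signature and the Cartesian Yoneda functor\<close>

context
  fixes C :: "('v::set_universe, 'v set_map) category"
  assumes exp: "exponential_category C"
begin

lemma exp_functor_eq: "exp_functor C B = set_functor C (\<lambda>A. vexp A B) (\<lambda>h. vcomp (und h))"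
  by (simp add: exp_functor_def set_functor_def postcomp_def sfun_def exp_simps[OF exp])

lemma FOb_exp_functor: "A \<in> Ob C \<Longrightarrow> FOb (exp_functor C B) A = vexp A B"
  by (simp add: exp_functor_eq)

lemma vcomp_und_funcset:
  "h \<in> hom C A A' \<Longrightarrow> vcomp (und h) \<in> elts (vexp A B) \<rightarrow> elts (vexp A' B)"
  by (auto simp: exp_hom[OF exp] intro: vcomp_vexp)

lemma sapp_exp_functor:
  "h \<in> hom C A A' \<Longrightarrow> g \<in> elts (vexp A B) \<Longrightarrow> sapp (FAr (exp_functor C B) h) g = vcomp (und h) g"
  by (simp add: exp_functor_eq FAr_set_functor sapp_sfun[OF vcomp_und_funcset])

lemma is_functor_exp_functor:
  assumes B: "B \<in> Ob C"
  shows "is_functor C C (exp_functor C B)"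
  unfolding exp_functor_eq
proof (rule is_functor_set_functor[OF exp exp_category[OF exp]])
  show "vexp A B \<in> Ob C" if "A \<in> Ob C" for A
    using exp_vexp[OF exp that B] .
  show "vcomp (und (Ident C A)) g = g" if "g \<in> elts (vexp A B)" for A g
    using that by (simp add: exp_simps[OF exp] vcomp_id_left)
  show "vcomp (und (Comp C k h)) g = vcomp (und k) (vcomp (und h) g)"
    if "h \<in> hom C A A'" "k \<in> hom C A' A''" "g \<in> elts (vexp A B)" for A A' A'' h k g
    using that by (auto simp: exp_simps[OF exp] exp_hom[OF exp] intro: vcomp_assoc[symmetric])
qed (rule vcomp_und_funcset)

lemma precomp_eq:
  "f \<in> hom C B' B \<Longrightarrow> precomp f A = sfun (vexp A B) (\<lambda>g. vcomp g (und f)) (vexp A B')"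
  by (simp add: precomp_def sfun_def exp_hom[OF exp])

lemma precomp_funcset:
  "f \<in> hom C B' B \<Longrightarrow> (\<lambda>g. vcomp g (und f)) \<in> elts (vexp A B) \<rightarrow> elts (vexp A B')"
  by (auto simp: exp_hom[OF exp] intro: vcomp_vexp)

text \<open>Naturality says that composing on the left with \<open>h\<close> commutes with composing
  on the right with \<open>f\<close>, which is associativity.\<close>

lemma is_nat_trans_precomp:
  assumes f: "f \<in> hom C B' B"
  shows "is_nat_trans C C (exp_functor C B) (exp_functor C B') (\<lambda>A\<in>Ob C. precomp f A)"
proof -
  have B: "B \<in> Ob C" "B' \<in> Ob C" using f by (auto simp: exp_hom[OF exp])
  have "(\<lambda>A\<in>Ob C. precomp f A) =
    (\<lambda>A\<in>Ob C. sfun (FOb (exp_functor C B) A) (\<lambda>g. vcomp g (und f)) (FOb (exp_functor C B') A))"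
    by (auto simp: precomp_eq[OF f] FOb_exp_functor)
  moreover have "is_nat_trans C C (exp_functor C B) (exp_functor C B') \<dots>"
  proof (rule is_nat_trans_sfun[OF exp is_functor_exp_functor[OF B(1)] is_functor_exp_functor[OF B(2)]])
    show "(\<lambda>g. vcomp g (und f)) \<in> elts (FOb (exp_functor C B) A) \<rightarrow> elts (FOb (exp_functor C B') A)"
      if "A \<in> Ob C" for A
      using precomp_funcset[OF f] by (simp add: FOb_exp_functor that)
    fix A A' h g
    assume h: "h \<in> hom C A A'" and "g \<in> elts (FOb (exp_functor C B) A)"
    then have g: "g \<in> elts (vexp A B)" by (simp add: FOb_exp_functor exp_hom[OF exp])
    have gf: "vcomp g (und f) \<in> elts (vexp A B')" using precomp_funcset[OF f] g by blast
    show "vcomp (sapp (FAr (exp_functor C B) h) g) (und f) =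
        sapp (FAr (exp_functor C B') h) (vcomp g (und f))"
      unfolding sapp_exp_functor[OF h g] sapp_exp_functor[OF h gf]
      using f g h by (intro vcomp_assoc[symmetric]) (auto simp: exp_hom[OF exp])
  qed
  ultimately show ?thesis by simp
qed

lemma precomp_Ident:
  assumes "B \<in> Ob C"
  shows "precomp (Ident C B) A = Ident C (vexp A B)"
  unfolding precomp_eq[OF Ident_hom[OF exp_category[OF exp] assms]]
  by (auto simp: sfun_def exp_simps[OF exp] intro!: graph_cong vcomp_id_right)

text \<open>Precomposition reverses composites, again by associativity; the opposite category in the
  Yoneda signature absorbs the reversal.\<close>

lemma precomp_Comp:
  assumes f: "f \<in> hom C B' B" and g: "g \<in> hom C B'' B'"
  shows "precomp (Comp C f g) A = Comp C (precomp g A) (precomp f A)"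
proof -
  have "graph (vexp A B) (\<lambda>k. vcomp k (und (Comp C f g))) =
      graph (vexp A B) (\<lambda>k. vcomp (vcomp k (und f)) (und g))"
    using f g by (intro graph_cong) (auto simp: exp_simps[OF exp] exp_hom[OF exp] intro: vcomp_assoc)
  then show ?thesis
    using vcomp_graph[OF precomp_funcset[OF f] precomp_funcset[OF g], of A]
    unfolding precomp_eq[OF f] precomp_eq[OF g] precomp_eq[OF Comp_hom[OF exp_category[OF exp] g f]]
    by (simp add: sfun_def exp_simps(4)[OF exp])
qed

end

section \<open>The Yoneda signature\<close>

context
  fixes C :: "('v::set_universe, 'v set_map) category"
    and I :: "('io, 'ia) category"
    and D :: "('do, 'da) category"
    and \<rho> :: "('io, 'ia, 'v, 'v set_map, 'do, 'da) presig"
  assumes exp: "exponential_category C" and sig: "signature I C D \<rho>"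
begin

abbreviation (input) "StrOp \<equiv> op_cat (Struct I C D \<rho>)"
abbreviation (input) "Yon \<equiv> yoneda_sig I C D \<rho>"

lemma is_category_StrOp: "is_category StrOp"
  by (rule is_category_op_cat[OF is_category_Struct[OF sig]])

lemma Struct_homD:
  assumes "f \<in> hom (Struct I C D \<rho>) X Y"
  shows "X \<in> structures I C D \<rho>" "Y \<in> structures I C D \<rho>" "src f = X" "trg f = Y"
    "und f \<in> hom C (fst X) (fst Y)" "f \<in> Ar (Struct I C D \<rho>)"
  using assms Struct_Ar_D[of f I C D \<rho>] by (auto simp: hom_iff[of f])

lemma presignature_Yon: "presignature StrOp C C Yon"
  unfolding presignature_def
proof (intro conjI)
  show C: "is_category C" by (rule exp_category[OF exp])
  show J: "is_category StrOp" by (rule is_category_StrOp)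
  show "is_functor StrOp (Fun_cat C C) Yon"
  proof (rule is_functorI[OF J is_category_Fun_cat])
    show "FOb Yon \<in> extensional (Ob StrOp)" "FAr Yon \<in> extensional (Ar StrOp)"
      by (simp_all add: yoneda_sig_def)
    show "FOb Yon X \<in> Ob (Fun_cat C C)" if "X \<in> Ob StrOp" for X
      using that by (simp add: yoneda_sig_def is_functor_exp_functor[OF exp] structuresD(1))
    \<comment> \<open>An arrow from \<open>X\<close> to \<open>Y\<close> in \<open>StrOp\<close> is
      a morphism of structures from \<open>Y\<close> to \<open>X\<close>, so precomposition with it
      leads from the powers with exponent \<open>fst X\<close> to those with exponent
      \<open>fst Y\<close>.\<close>
    show "FAr Yon f \<in> hom (Fun_cat C C) (FOb Yon X) (FOb Yon Y)" if f: "f \<in> hom StrOp X Y" for f X Y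
      using Struct_homD[OF f[unfolded hom_op_cat]]
      by (simp add: yoneda_sig_def hom_Fun_cat is_nat_trans_precomp[OF exp])
    show "FAr Yon (Ident StrOp X) = Ident (Fun_cat C C) (FOb Yon X)" if "X \<in> Ob StrOp" for X
      using that Struct_Ident_hom[OF sig, of X] precomp_Ident[OF exp structuresD(1), of X]
      by (auto simp: yoneda_sig_def FOb_exp_functor[OF exp] intro!: restrict_ext)
    show "FAr Yon (Comp StrOp g f) = Comp (Fun_cat C C) (FAr Yon g) (FAr Yon f)"
      if f: "f \<in> hom StrOp X Y" and g: "g \<in> hom StrOp Y Z" for f g X Y Z
    proof -
      note f' = Struct_homD[OF f[unfolded hom_op_cat]] and g' = Struct_homD[OF g[unfolded hom_op_cat]]
      have "Comp (Struct I C D \<rho>) f g \<in> Ar (Struct I C D \<rho>)"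
        using Comp_hom[OF J f g] f'(3,4) g'(3,4) unfolding hom_iff by simp
      then show ?thesis
        using f' g' by (auto simp: yoneda_sig_def precomp_Comp[OF exp f'(5) g'(5)] intro!: restrict_ext)
    qed
  qed
qed (rule exp_category[OF exp])

text \<open>Every arrow of \<open>Fun_cat StrOp C\<close> has an image, in particular the composites
  that the definition of a signature asks about.\<close>

lemma signature_Yon: "signature StrOp C C Yon"
  unfolding signature_def
proof (intro conjI ballI allI impI)
  show "presignature StrOp C C Yon" by (rule presignature_Yon)
  fix h F
  assume h: "h \<in> Ar C" and F: "is_mono (Fun_cat StrOp C) F \<and>
    Cod (Fun_cat StrOp C) F = sig_at StrOp Yon (Dom C h)"
  have h': "h \<in> hom C (Dom C h) (Cod C h)" using h by (simp add: hom_iff)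
  have "F \<in> hom (Fun_cat StrOp C) (Dom (Fun_cat StrOp C) F) (sig_at StrOp Yon (Dom C h))"
    using F is_mono_Ar[of _ F] unfolding hom_iff by blast
  from Comp_hom[OF is_category_Fun_cat this sig_map_hom[OF presignature_Yon h']]
  show "has_image (Fun_cat StrOp C) (Comp (Fun_cat StrOp C) (sig_map StrOp C Yon h) F)"
    by (rule has_image_Fun_cat[OF exp])
qed

section \<open>Hom sets as subfunctors\<close>

text \<open>Provides the bound that gives \<open>vset\<close> in \<open>vhom\<close> its meaning.
  The double \<open>und\<close> passes from a morphism of structures to its arrow in
  \<open>C\<close> and then to the graph.\<close>

lemma hom_graphs_subset:
  "(\<lambda>f. und (und f)) ` hom (Struct I C D \<rho>) X Y \<subseteq> elts (vexp (fst Y) (fst X))"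
proof (rule image_subsetI)
  fix f assume "f \<in> hom (Struct I C D \<rho>) X Y"
  from Struct_homD(5)[OF this] show "und (und f) \<in> elts (vexp (fst Y) (fst X))"
    by (simp add: exp_hom[OF exp])
qed

lemma elts_vhom:
  "elts (vhom I C D \<rho> X Y) = (\<lambda>f. und (und f)) ` hom (Struct I C D \<rho>) X Y"
  unfolding vhom_def by (rule elts_vset[OF hom_graphs_subset])

lemma vhom_subset: "elts (vhom I C D \<rho> X Y) \<subseteq> elts (vexp (fst Y) (fst X))"
  unfolding elts_vhom by (rule hom_graphs_subset)

text \<open>Composition in \<open>Struct I C D \<rho>\<close>, seen on graphs. Read in
  \<open>f\<close> it makes the hom sets into \<open>Y\<close> stable under precomposition; read in
  \<open>g\<close> it lets morphisms of structures act on hom sets.\<close>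

lemma vcomp_vhom:
  assumes "g \<in> elts (vhom I C D \<rho> Y Z)" "f \<in> hom (Struct I C D \<rho>) X Y"
  shows "vcomp g (und (und f)) \<in> elts (vhom I C D \<rho> X Z)"
proof -
  obtain k where k: "k \<in> hom (Struct I C D \<rho>) Y Z" "g = und (und k)"
    using assms(1) by (auto simp: elts_vhom)
  then show ?thesis
    unfolding elts_vhom
    using Comp_hom[OF is_category_Struct[OF sig] assms(2) k(1)]
    by (auto simp: exp_simps[OF exp] intro!: image_eqI)
qed

lemma FOb_Yon:
  "X \<in> structures I C D \<rho> \<Longrightarrow> A \<in> Ob C \<Longrightarrow> FOb (FOb Yon X) A = vexp A (fst X)"
  by (simp add: yoneda_sig_def FOb_exp_functor[OF exp])

lemma sapp_sig_at_Yon: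
  assumes "f \<in> hom (Struct I C D \<rho>) X Y" "A \<in> Ob C" "g \<in> elts (vexp A (fst Y))"
  shows "sapp (FAr (sig_at StrOp Yon A) f) g = vcomp g (und (und f))"
  using Struct_homD[OF assms(1)] assms(2,3)
  by (simp add: yoneda_sig_def precomp_eq[OF exp] sapp_sfun[OF precomp_funcset[OF exp]])

lemma sapp_sig_map_Yon:
  assumes "X \<in> structures I C D \<rho>" "h \<in> hom C A B" "g \<in> elts (vexp A (fst X))"
  shows "sapp (und (sig_map StrOp C Yon h) X) g = vcomp (und h) g"
  using assms by (simp add: sig_map_def yoneda_sig_def sapp_exp_functor[OF exp])

lemma stable_family_vhom:
  assumes Y: "Y \<in> structures I C D \<rho>"
  shows "stable_family StrOp (sig_at StrOp Yon (fst Y)) (\<lambda>X. vhom I C D \<rho> X Y)"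
  unfolding stable_family_def
proof (intro conjI ballI)
  show "elts (vhom I C D \<rho> X Y) \<subseteq> elts (FOb (sig_at StrOp Yon (fst Y)) X)" if "X \<in> Ob StrOp" for X
    using that vhom_subset[of X Y] FOb_Yon[OF _ structuresD(1)[OF Y], of X] by simp
  fix f g assume "f \<in> Ar StrOp" and g: "g \<in> elts (vhom I C D \<rho> (Dom StrOp f) Y)"
  then have f: "f \<in> hom (Struct I C D \<rho>) (Cod StrOp f) (Dom StrOp f)" by (simp add: hom_iff)
  show "sapp (FAr (sig_at StrOp Yon (fst Y)) f) g \<in> elts (vhom I C D \<rho> (Cod StrOp f) Y)"
    using sapp_sig_at_Yon[OF f structuresD(1)[OF Y] subsetD[OF vhom_subset g]] vcomp_vhom[OF g f]
    by simp
qed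

text \<open>Both sides act by precomposition. Graphs ignore what the HOL functions do off their
  domain, so this is an equality of functors and transformations, and the results on inclusions
  apply directly.\<close>

lemma Yo_incl_eq:
  assumes Y: "Y \<in> structures I C D \<rho>"
  shows "Yo_incl I C D \<rho> Y = inclusion StrOp (sig_at StrOp Yon (fst Y)) (\<lambda>X. vhom I C D \<rho> X Y)"
proof -
  let ?R = "sig_at StrOp Yon (fst Y)" and ?V = "\<lambda>X. vhom I C D \<rho> X Y"
  have "graph (?V (trg f)) (\<lambda>g. vcomp g (und (und f))) = graph (?V (trg f)) (sapp (FAr ?R f))"
    if "f \<in> Ar (Struct I C D \<rho>)" for f
  proof (rule graph_cong)
    have f: "f \<in> hom (Struct I C D \<rho>) (src f) (trg f)" using that by (simp add: hom_iff)
    show "vcomp g (und (und f)) = sapp (FAr ?R f) g" if "g \<in> elts (?V (trg f))" for g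
      using sapp_sig_at_Yon[OF f structuresD(1)[OF Y] subsetD[OF vhom_subset that]] by simp
  qed
  then have "Yo I C D \<rho> Y = subfunctor StrOp ?R ?V"
    by (simp add: Yo_def subfunctor_def set_functor_def sfun_def cong: restrict_cong)
  then show ?thesis
    by (simp add: Yo_incl_def inclusion_def sfun_def FOb_Yon structuresD(1)[OF Y] cong: restrict_cong)
qed

lemma
  assumes Y: "Y \<in> structures I C D \<rho>"
  shows Yo_incl_hom: "Yo_incl I C D \<rho> Y \<in>
      hom (Fun_cat StrOp C) (Yo I C D \<rho> Y) (sig_at StrOp Yon (fst Y))"
    and is_mono_Yo_incl: "is_mono (Fun_cat StrOp C) (Yo_incl I C D \<rho> Y)"
    and mono_le_Yo_incl_iff: "t \<in> hom (Fun_cat StrOp C) U (sig_at StrOp Yon (fst Y)) \<Longrightarrow>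
      mono_le (Fun_cat StrOp C) t (Yo_incl I C D \<rho> Y) \<longleftrightarrow>
      (\<forall>X\<in>structures I C D \<rho>. \<forall>g\<in>elts (FOb U X). sapp (und t X) g \<in> elts (vhom I C D \<rho> X Y))"
    and sapp_Yo_incl: "X \<in> structures I C D \<rho> \<Longrightarrow> g \<in> elts (vhom I C D \<rho> X Y) \<Longrightarrow>
      sapp (und (Yo_incl I C D \<rho> Y) X) g = g"
proof -
  note R = is_functor_sig_at[OF presignature_Yon structuresD(1)[OF Y]]
  note st = stable_family_vhom[OF Y]
  show 1: "Yo_incl I C D \<rho> Y \<in> hom (Fun_cat StrOp C) (Yo I C D \<rho> Y) (sig_at StrOp Yon (fst Y))"
    using inclusion_hom[OF exp R st] unfolding Yo_incl_eq[OF Y, symmetric]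
    by (simp add: hom_Fun_cat Yo_incl_def)
  show "is_mono (Fun_cat StrOp C) (Yo_incl I C D \<rho> Y)"
    unfolding Yo_incl_eq[OF Y] by (rule is_mono_inclusion[OF exp R st])
  show "mono_le (Fun_cat StrOp C) t (Yo_incl I C D \<rho> Y) \<longleftrightarrow>
      (\<forall>X\<in>structures I C D \<rho>. \<forall>g\<in>elts (FOb U X). sapp (und t X) g \<in> elts (vhom I C D \<rho> X Y))"
    if "t \<in> hom (Fun_cat StrOp C) U (sig_at StrOp Yon (fst Y))"
    unfolding Yo_incl_eq[OF Y] mono_le_inclusion_iff[OF exp R st that] by simp
  show "sapp (und (Yo_incl I C D \<rho> Y) X) g = g"
    if "X \<in> structures I C D \<rho>" "g \<in> elts (vhom I C D \<rho> X Y)"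
    unfolding Yo_incl_eq[OF Y] using that by (intro sapp_inclusion[OF exp R st]) simp_all
qed

section \<open>The Cartesian Yoneda functor\<close>

lemma fst_Ca_ob [simp]: "fst (Ca_ob I C D \<rho> Y) = fst Y"
  by (simp add: Ca_ob_def)

lemma
  assumes Y: "Y \<in> structures I C D \<rho>"
  shows Ca_ob_structure: "Ca_ob I C D \<rho> Y \<in> structures StrOp C C Yon"
    and Yo_incl_in_Ca_ob: "Yo_incl I C D \<rho> Y \<in> snd (Ca_ob I C D \<rho> Y)"
proof -
  show "Yo_incl I C D \<rho> Y \<in> snd (Ca_ob I C D \<rho> Y)"
    using self_in_subobject[OF is_category_Fun_cat is_mono_Yo_incl[OF Y]] by (simp add: Ca_ob_def)
  have "Cod (Fun_cat StrOp C) (Yo_incl I C D \<rho> Y) = sig_at StrOp Yon (fst Y)"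
    by (simp add: Yo_incl_def)
  then show "Ca_ob I C D \<rho> Y \<in> structures StrOp C C Yon"
    using structuresD(1)[OF Y] is_mono_Yo_incl[OF Y]
    unfolding structures_def subobjects_def Ca_ob_def by blast
qed

text \<open>Right to left, this makes \<open>Ca\<close> well defined on arrows; left to right, it
  gives fullness.\<close>

lemma Ca_Ar_iff:
  assumes Y: "Y \<in> structures I C D \<rho>" and Z: "Z \<in> structures I C D \<rho>"
    and h: "h \<in> hom C (fst Y) (fst Z)"
  shows "Arrow (Ca_ob I C D \<rho> Y) h (Ca_ob I C D \<rho> Z) \<in> Ar (Yoneda_Struct I C D \<rho>) \<longleftrightarrow>
    Arrow Y h Z \<in> Ar (Struct I C D \<rho>)"
proof -
  let ?K = "Fun_cat StrOp C" and ?t = "sig_map StrOp C Yon h"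
  note S = is_category_Struct[OF sig]
  note t = sig_map_hom[OF presignature_Yon h] and F = Yo_incl_hom[OF Y]
  have app: "sapp (und (Comp ?K ?t (Yo_incl I C D \<rho> Y)) X) g = vcomp (und h) g"
    if X: "X \<in> structures I C D \<rho>" and g: "g \<in> elts (vhom I C D \<rho> X Y)" for X g
  proof -
    have "g \<in> elts (vexp (fst Y) (fst X))" using g vhom_subset by blast
    moreover have "X \<in> Ob StrOp" "g \<in> elts (FOb (Yo I C D \<rho> Y) X)" using X g by (simp_all add: Yo_def)
    ultimately show ?thesis
      using sapp_Comp_Fun[OF exp F t] by (simp add: sapp_Yo_incl[OF Y X g] sapp_sig_map_Yon[OF X h] del: Fun_cat_simps)
  qed
  have "Arrow (Ca_ob I C D \<rho> Y) h (Ca_ob I C D \<rho> Z) \<in> Ar (Yoneda_Struct I C D \<rho>) \<longleftrightarrow>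
      mono_le ?K (Comp ?K ?t (Yo_incl I C D \<rho> Y)) (Yo_incl I C D \<rho> Z)"
    unfolding Yoneda_Struct_def using h
    by (intro Struct_Ar_iff[OF signature_Yon] Ca_ob_structure Yo_incl_in_Ca_ob Y Z) simp
  also have "\<dots> \<longleftrightarrow> (\<forall>X\<in>structures I C D \<rho>. \<forall>g\<in>elts (vhom I C D \<rho> X Y).
      vcomp (und h) g \<in> elts (vhom I C D \<rho> X Z))"
    unfolding mono_le_Yo_incl_iff[OF Z Comp_hom[OF is_category_Fun_cat F t]]
    using app by (auto simp: Yo_def simp del: Fun_cat_simps)
  also have "\<dots> \<longleftrightarrow> Arrow Y h Z \<in> Ar (Struct I C D \<rho>)"
  proof
    assume *: "\<forall>X\<in>structures I C D \<rho>. \<forall>g\<in>elts (vhom I C D \<rho> X Y).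
      vcomp (und h) g \<in> elts (vhom I C D \<rho> X Z)"
    have "Ident (Struct I C D \<rho>) Y \<in> hom (Struct I C D \<rho>) Y Y" using Ident_hom[OF S] Y by simp
    then have "und (und (Ident (Struct I C D \<rho>) Y)) \<in> elts (vhom I C D \<rho> Y Y)"
      unfolding elts_vhom by blast
    then have "vcomp (und h) (graph (fst Y) (\<lambda>x. x)) \<in> elts (vhom I C D \<rho> Y Z)"
      using * Y by (simp add: exp_simps[OF exp])
    moreover have "und h \<in> elts (vexp (fst Z) (fst Y))" using h by (simp add: exp_hom[OF exp])
    ultimately have "und h \<in> elts (vhom I C D \<rho> Y Z)" by (simp add: vcomp_id_right)
    then obtain k where k: "k \<in> hom (Struct I C D \<rho>) Y Z" "und h = und (und k)"
      unfolding elts_vhom by blast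
    \<comment> \<open>So far only the graphs of \<open>h\<close> and \<open>k\<close> agree. Arrows
      of \<open>C\<close> and of \<open>Struct I C D \<rho>\<close> also carry their endpoints, so
      equality is recovered one level at a time.\<close>
    have "h = und k"
      using h k(2) Struct_homD(5)[OF k(1)] by (intro arrow.expand) (simp_all add: exp_hom[OF exp])
    then have "Arrow Y h Z = k" using Struct_homD(3,4)[OF k(1)] by (intro arrow.expand) simp_all
    then show "Arrow Y h Z \<in> Ar (Struct I C D \<rho>)" using Struct_homD(6)[OF k(1)] by simp
  next
    assume h: "Arrow Y h Z \<in> Ar (Struct I C D \<rho>)"
    then have hZ: "und h \<in> elts (vhom I C D \<rho> Y Z)"
      unfolding elts_vhom by (intro image_eqI[of _ _ "Arrow Y h Z"]) (simp_all add: hom_iff)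
    show "\<forall>X\<in>structures I C D \<rho>. \<forall>g\<in>elts (vhom I C D \<rho> X Y).
      vcomp (und h) g \<in> elts (vhom I C D \<rho> X Z)"
      using vcomp_vhom[OF hZ] elts_vhom by auto
  qed
  finally show ?thesis .
qed

lemma FAr_Ca: "f \<in> hom (Struct I C D \<rho>) Y Z \<Longrightarrow>
    FAr (Ca I C D \<rho>) f = Arrow (Ca_ob I C D \<rho> Y) (und f) (Ca_ob I C D \<rho> Z)"
  using Struct_homD[of f Y Z] by (simp add: Ca_def)

lemma FOb_Ca: "Y \<in> structures I C D \<rho> \<Longrightarrow> FOb (Ca I C D \<rho>) Y = Ca_ob I C D \<rho> Y"
  by (simp add: Ca_def)

lemma FAr_Ca_hom:
  assumes f: "f \<in> hom (Struct I C D \<rho>) Y Z"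
  shows "FAr (Ca I C D \<rho>) f \<in> hom (Yoneda_Struct I C D \<rho>) (Ca_ob I C D \<rho> Y) (Ca_ob I C D \<rho> Z)"
proof -
  note f' = Struct_homD[OF f]
  have "Arrow Y (und f) Z = f" using f'(3,4) by (intro arrow.expand) simp_all
  then have "Arrow (Ca_ob I C D \<rho> Y) (und f) (Ca_ob I C D \<rho> Z) \<in> Ar (Yoneda_Struct I C D \<rho>)"
    using Ca_Ar_iff[OF f'(1,2,5)] f'(6) by simp
  then show ?thesis unfolding FAr_Ca[OF f] by (simp add: hom_iff Yoneda_Struct_def)
qed

lemma is_functor_Ca: "is_functor (Struct I C D \<rho>) (Yoneda_Struct I C D \<rho>) (Ca I C D \<rho>)"
proof (rule is_functorI)
  show S: "is_category (Struct I C D \<rho>)" by (rule is_category_Struct[OF sig])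
  show "is_category (Yoneda_Struct I C D \<rho>)"
    unfolding Yoneda_Struct_def by (rule is_category_Struct[OF signature_Yon])
  show "FOb (Ca I C D \<rho>) \<in> extensional (Ob (Struct I C D \<rho>))"
    "FAr (Ca I C D \<rho>) \<in> extensional (Ar (Struct I C D \<rho>))"
    by (simp_all add: Ca_def)
  show "FOb (Ca I C D \<rho>) Y \<in> Ob (Yoneda_Struct I C D \<rho>)" if "Y \<in> Ob (Struct I C D \<rho>)" for Y
    using that by (simp add: FOb_Ca Yoneda_Struct_def Ca_ob_structure)
  show "FAr (Ca I C D \<rho>) f \<in> hom (Yoneda_Struct I C D \<rho>) (FOb (Ca I C D \<rho>) Y) (FOb (Ca I C D \<rho>) Z)"
    if "f \<in> hom (Struct I C D \<rho>) Y Z" for f Y Z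
    using FAr_Ca_hom[OF that] Struct_homD[OF that] by (simp add: FOb_Ca)
  show "FAr (Ca I C D \<rho>) (Ident (Struct I C D \<rho>) Y) = Ident (Yoneda_Struct I C D \<rho>) (FOb (Ca I C D \<rho>) Y)"
    if "Y \<in> Ob (Struct I C D \<rho>)" for Y
    using that FAr_Ca[OF Ident_hom[OF S that]] by (simp add: FOb_Ca Yoneda_Struct_def)
  show "FAr (Ca I C D \<rho>) (Comp (Struct I C D \<rho>) g f) =
      Comp (Yoneda_Struct I C D \<rho>) (FAr (Ca I C D \<rho>) g) (FAr (Ca I C D \<rho>) f)"
    if "f \<in> hom (Struct I C D \<rho>) X Y" "g \<in> hom (Struct I C D \<rho>) Y Z" for f g X Y Z
    using FAr_Ca[OF Comp_hom[OF S that]] by (simp add: FAr_Ca[OF that(1)] FAr_Ca[OF that(2)] Yoneda_Struct_def)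
qed

lemma full_Ca: "full (Struct I C D \<rho>) (Yoneda_Struct I C D \<rho>) (Ca I C D \<rho>)"
  unfolding full_def
proof (intro ballI equalityI subsetI)
  fix Y Z k assume "Y \<in> Ob (Struct I C D \<rho>)" "Z \<in> Ob (Struct I C D \<rho>)"
  then have YZ: "Y \<in> structures I C D \<rho>" "Z \<in> structures I C D \<rho>" by simp_all
  show "k \<in> hom (Yoneda_Struct I C D \<rho>) (FOb (Ca I C D \<rho>) Y) (FOb (Ca I C D \<rho>) Z)"
    if "k \<in> FAr (Ca I C D \<rho>) ` hom (Struct I C D \<rho>) Y Z"
    using that FAr_Ca_hom[of _ Y Z] by (auto simp: FOb_Ca YZ)
  assume "k \<in> hom (Yoneda_Struct I C D \<rho>) (FOb (Ca I C D \<rho>) Y) (FOb (Ca I C D \<rho>) Z)"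
  then have k: "k \<in> Ar (Yoneda_Struct I C D \<rho>)" "src k = Ca_ob I C D \<rho> Y" "trg k = Ca_ob I C D \<rho> Z"
    by (simp_all add: hom_iff FOb_Ca YZ Yoneda_Struct_def)
  have kA: "k = Arrow (Ca_ob I C D \<rho> Y) (und k) (Ca_ob I C D \<rho> Z)"
    using k by (intro arrow.expand) simp_all
  \<comment> \<open>\<open>Ca_ob\<close> keeps the underlying object, so the arrow inside
    \<open>k\<close> already runs between the objects on which \<open>Y\<close> and \<open>Z\<close>
    live.\<close>
  have "und k \<in> hom C (fst Y) (fst Z)"
    using Struct_Ar_D(3)[OF k(1)[unfolded Yoneda_Struct_def]] k by simp
  with k(1) kA have f: "Arrow Y (und k) Z \<in> hom (Struct I C D \<rho>) Y Z"
    using Ca_Ar_iff[OF YZ, of "und k"] by (simp add: hom_iff)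
  then show "k \<in> FAr (Ca I C D \<rho>) ` hom (Struct I C D \<rho>) Y Z"
    using FAr_Ca[OF f] kA by (intro image_eqI[OF _ f]) simp
qed

text \<open>\<open>Ca\<close> keeps the underlying arrow of \<open>C\<close>, and membership in the
  hom set fixes the endpoints.\<close>

lemma faithful_Ca: "faithful (Struct I C D \<rho>) (Yoneda_Struct I C D \<rho>) (Ca I C D \<rho>)"
  unfolding faithful_def
proof (intro ballI inj_onI)
  fix Y Z f g assume f: "f \<in> hom (Struct I C D \<rho>) Y Z" and g: "g \<in> hom (Struct I C D \<rho>) Y Z"
    and "FAr (Ca I C D \<rho>) f = FAr (Ca I C D \<rho>) g"
  then have "und f = und g" by (simp add: FAr_Ca)
  then show "f = g" using Struct_homD(3,4)[OF f] Struct_homD(3,4)[OF g] by (intro arrow.expand) simp_all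
qed

end


theorem proposition9:
  fixes C :: "('v::set_universe, 'v set_map) category"
    and I :: "('io, 'ia) category"
    and D :: "('do, 'da) category"
    and \<rho> :: "('io, 'ia, 'v, 'v set_map, 'do, 'da) presig"
  assumes "exponential_category C"
    and "signature I C D \<rho>"
  shows "is_functor (Struct I C D \<rho>) (Yoneda_Struct I C D \<rho>) (Ca I C D \<rho>) \<and>
         full (Struct I C D \<rho>) (Yoneda_Struct I C D \<rho>) (Ca I C D \<rho>) \<and>
         faithful (Struct I C D \<rho>) (Yoneda_Struct I C D \<rho>) (Ca I C D \<rho>)"
  using is_functor_Ca[OF assms] full_Ca[OF assms] faithful_Ca[OF assms] by blast

end
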